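(* There exist constants $c_0>0$, $C\ge1$ and $\alpha>0$, all independent of the mesh size $H$ and the frequency $\omega\ge\omega_0$, such that under the resolution condition $\omega H\le c_0$ the following hold, where $\mathbf{W}=\ker\pi_H^E$. (i) For every $\mathbf{w}\in\mathbf{W}$, decomposed as $\mathbf{w}=\mathbf{z}+\nabla\theta$ with $\mathbf{z}\in\mathbf{H}^1_0(\Omega)$, $\theta\in H^1_0(\Omega)$ according to the regular decomposition associated with $\pi_H^E$ (see context), setting $|||\mathbf{w}|||^2:=\|\mathrm{curl}\,\mathbf{z}\|_{L^2(\Omega)}^2+\omega^2\|\nabla\theta\|_{L^2(\Omega)}^2$, one has $$C^{-1}\|\mathbf{w}\|_{\mathrm{curl},\omega}\le|||\mathbf{w}|||\le C\|\mathbf{w}\|_{\mathrm{curl},\omega}.$$ (ii) $$\inf_{\mathbf{w}\in\mathbf{W}\setminus\{0\}}\ \sup_{\boldsymbol{\phi}\in\mathbf{W}\setminus\{0\}}\frac{|\mathcal{B}(\mathbf{w},\boldsymbol{\phi})|}{\|\mathbf{w}\|_{\mathrm{curl},\omega}\|\boldsymbol{\phi}\|_{\mathrm{curl},\omega}}\ge\alpha.$$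
   Context: Setting. $\Omega\subset\mathbb{R}^3$ is an open, bounded, contractible domain with polyhedral Lipschitz boundary. All functions are complex-valued; $(\cdot,\cdot)_{L^2(\Omega)}$ is the complex $L^2$ inner product (conjugate-linear in the second argument). $\mathbf{H}_0(\mathrm{curl})=\mathbf{H}_0(\mathrm{curl},\Omega)$ is the usual space with zero tangential trace. $\|\cdot\|_{\mathrm{curl},\omega}$ is the norm of the inner product $(\mathbf{v},\mathbf{w})_{\mathrm{curl},\omega}=(\mathrm{curl}\,\mathbf{v},\mathrm{curl}\,\mathbf{w})_{L^2(\Omega)}+\omega^2(\mathbf{v},\mathbf{w})_{L^2(\Omega)}$. The coefficients $\mu,\varepsilon\in L^\infty(\Omega,\mathbb{R}^{3\times3})$ are uniformly elliptic, and $$\mathcal{B}(\mathbf{v},\boldsymbol{\psi})=(\mu\,\mathrm{curl}\,\mathbf{v},\mathrm{curl}\,\boldsymbol{\psi})_{L^2(\Omega)}-\omega^2(\varepsilon\mathbf{v},\boldsymbol{\psi})_{L^2(\Omega)}.$$ The frequency satisfies $\omega\ge\omega_0$ for a fixed $\omega_0>0$ and is not an eigenvalue, i.e. the problem $\mathcal{B}(\mathbf{u},\cdot)=(\mathbf{f},\cdot)_{L^2(\Omega)}$ on $\mathbf{H}_0(\mathrm{curl})$ is uniquely solvable. Mesh. $\mathcal{T}_H$ is a regular (conforming), shape-regular, quasi-uniform partition of $\Omega$ into tetrahedra, $H=\max_T\mathrm{diam}(T)$. For $G\subset\overline\Omega$, $\mathrm{N}(G)=\mathrm{N}^1(G)=\mathrm{int}(\bigcup\{T\in\mathcal{T}_H: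 T\cap\overline G\ne\emptyset\})$ and $\mathrm{N}^m(G)=\mathrm{N}(\mathrm{N}^{m-1}(G))$. $\mathring{\mathcal{N}}(\mathcal{T}_H)=\{\mathbf{v}\in\mathbf{H}_0(\mathrm{curl}):\mathbf{v}|_T(\mathbf{x})=\mathbf{a}_T\times\mathbf{x}+\mathbf{b}_T,\ \mathbf{a}_T,\mathbf{b}_T\in\mathbb{C}^3\ \forall T\in\mathcal{T}_H\}$ is the lowest-order Nédélec space. Constants said to be independent of $H,\omega$ may depend on $\Omega$, on the shape-regularity and quasi-uniformity constants, on the bounds and ellipticity constants of $\mu,\varepsilon$, and on $\omega_0$. Interpolation. $\pi_H^E:\mathbf{H}_0(\mathrm{curl})\to\mathring{\mathcal{N}}(\mathcal{T}_H)$ is the Falk–Winther interpolation operator (local bounded cochain projection), a linear projection commuting with the exterior derivative (i.e. forming a commuting diagram with the corresponding projections onto the continuous piecewise linear space and the Raviart–Thomas space) and satisfying, with constants independent of $H$: for all $\mathbf{v}\in\mathbf{H}_0(\mathrm{curl})$, $T\in\mathcal{T}_H$, $\|\pi_H^E\mathbf{v}\|_{L^2(T)}\lesssim\|\mathbf{v}\|_{L^2(\mathrm{N}(T))}+H\|\mathrm{curl}\,\mathbf{v}\|_{L^2(\mathrm{N}(T))}$, $\|\mathrm{curl}\,\pi_H^E\mathbf{v}\|_{L^2(T)}\lesssim\|\mathrm{curl}\,\mathbf{v}\|_{L^2(\mathrm{N}(T))}$. Regular decomposition associated with $\pi_H^E$: for every $\mathbf{v}\in\mathbf{H}_0(\mathrm{curl})$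 there are $\mathbf{z}\in\mathbf{H}^1_0(\Omega)$, $\theta\in H^1_0(\Omega)$ with $\mathbf{v}-\pi_H^E\mathbf{v}=\mathbf{z}+\nabla\theta$ and, for all $T\in\mathcal{T}_H$ with constants independent of $H$, $H^{-1}\|\mathbf{z}\|_{L^2(T)}+\|\nabla\mathbf{z}\|_{L^2(T)}\lesssim\|\mathrm{curl}\,\mathbf{v}\|_{L^2(\mathrm{N}^3(T))}$ and $H^{-1}\|\theta\|_{L^2(T)}+\|\nabla\theta\|_{L^2(T)}\lesssim\|\mathbf{v}\|_{L^2(\mathrm{N}^3(T))}+H\|\mathrm{curl}\,\mathbf{v}\|_{L^2(\mathrm{N}^3(T))}$. For $\mathbf{w}\in\mathbf{W}$ one has $\pi_H^E\mathbf{w}=0$, so this gives $\mathbf{w}=\mathbf{z}+\nabla\theta$. *)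

theory Defs
  imports "HOL-Analysis.Analysis"
begin

section \<open>Smooth test functions and classical differential operators\<close>

definition partial :: "3 \<Rightarrow> (real^3 \<Rightarrow> 'b::real_normed_vector) \<Rightarrow> real^3 \<Rightarrow> 'b" where
  "partial i f x = frechet_derivative f (at x) (axis i 1)"

primrec times_cont_diff :: "nat \<Rightarrow> (real^3 \<Rightarrow> 'b::real_normed_vector) \<Rightarrow> bool" where
  "times_cont_diff 0 f \<longleftrightarrow> continuous_on UNIV f"
| "times_cont_diff (Suc k) f \<longleftrightarrow>
     f differentiable_on UNIV \<and> (\<forall>i. times_cont_diff k (partial i f))"

definition test_functions :: "(real^3) set \<Rightarrow> (real^3 \<Rightarrow> 'b::real_normed_vector) set" where
  "test_functions \<Omega> = {\<phi>. (\<forall>k. times_cont_diff k \<phi>) \<and>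
     compact (closure {x. \<phi> x \<noteq> 0}) \<and> closure {x. \<phi> x \<noteq> 0} \<subseteq> \<Omega>}"

definition grad :: "(real^3 \<Rightarrow> complex) \<Rightarrow> real^3 \<Rightarrow> complex^3" where
  "grad f x = (\<chi> i. partial i f x)"

definition divergence :: "(real^3 \<Rightarrow> complex^3) \<Rightarrow> real^3 \<Rightarrow> complex" where
  "divergence f x = (\<Sum>i\<in>UNIV. partial i (\<lambda>y. f y $ i) x)"

definition curl :: "(real^3 \<Rightarrow> complex^3) \<Rightarrow> real^3 \<Rightarrow> complex^3" where
  "curl f x = vector
     [partial 2 (\<lambda>y. f y $ 3) x - partial 3 (\<lambda>y. f y $ 2) x,
      partial 3 (\<lambda>y. f y $ 1) x - partial 1 (\<lambda>y. f y $ 3) x,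
      partial 1 (\<lambda>y. f y $ 2) x - partial 2 (\<lambda>y. f y $ 1) x]"


section \<open>Square integrable functions\<close>

text \<open>Elements of the function spaces below are functions, not equivalence classes: values
  outside \<open>\<Omega>\<close> are irrelevant, and elements are identified by \<open>ae_eq\<close>.\<close>

definition ae_eq :: "(real^3) set \<Rightarrow> (real^3 \<Rightarrow> 'b) \<Rightarrow> (real^3 \<Rightarrow> 'b) \<Rightarrow> bool" where
  "ae_eq \<Omega> v w \<longleftrightarrow> (AE x in lebesgue_on \<Omega>. v x = w x)"

definition L2 :: "(real^3) set \<Rightarrow> (real^3 \<Rightarrow> 'b::euclidean_space) set" where
  "L2 \<Omega> = {v. v \<in> borel_measurable (lebesgue_on \<Omega>) \<and>
                integrable (lebesgue_on \<Omega>) (\<lambda>x. (norm (v x))\<^sup>2)}"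

text \<open>For matrix-valued functions, \<open>norm\<close> on \<open>complex^3^3\<close> is the Frobenius norm.\<close>

definition L2_norm :: "(real^3) set \<Rightarrow> (real^3 \<Rightarrow> 'b::euclidean_space) \<Rightarrow> real" where
  "L2_norm S v = sqrt (\<integral>x. (norm (v x))\<^sup>2 \<partial>lebesgue_on S)"

definition L2_inner :: "(real^3) set \<Rightarrow> (real^3 \<Rightarrow> complex^3) \<Rightarrow> (real^3 \<Rightarrow> complex^3) \<Rightarrow> complex"
  where "L2_inner \<Omega> v w = (\<integral>x. (\<Sum>i\<in>UNIV. v x $ i * cnj (w x $ i)) \<partial>lebesgue_on \<Omega>)"

definition L2_inner_scalar :: "(real^3) set \<Rightarrow> (real^3 \<Rightarrow> complex) \<Rightarrow> (real^3 \<Rightarrow> complex) \<Rightarrow> complex"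
  where "L2_inner_scalar \<Omega> u v = (\<integral>x. u x * cnj (v x) \<partial>lebesgue_on \<Omega>)"


section \<open>Weak derivatives and Sobolev spaces\<close>

definition has_weak_grad :: "(real^3) set \<Rightarrow> (real^3 \<Rightarrow> complex) \<Rightarrow> (real^3 \<Rightarrow> complex^3) \<Rightarrow> bool" where
  "has_weak_grad \<Omega> u g \<longleftrightarrow> g \<in> L2 \<Omega> \<and>
     (\<forall>\<phi>\<in>test_functions \<Omega>. L2_inner_scalar \<Omega> u (divergence \<phi>) = - L2_inner \<Omega> g \<phi>)"

definition has_weak_curl :: "(real^3) set \<Rightarrow> (real^3 \<Rightarrow> complex^3) \<Rightarrow> (real^3 \<Rightarrow> complex^3) \<Rightarrow> bool" where
  "has_weak_curl \<Omega> v g \<longleftrightarrow> g \<in> L2 \<Omega> \<and>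
     (\<forall>\<phi>\<in>test_functions \<Omega>. L2_inner \<Omega> v (curl \<phi>) = L2_inner \<Omega> g \<phi>)"

definition has_weak_div :: "(real^3) set \<Rightarrow> (real^3 \<Rightarrow> complex^3) \<Rightarrow> (real^3 \<Rightarrow> complex) \<Rightarrow> bool" where
  "has_weak_div \<Omega> v d \<longleftrightarrow> d \<in> L2 \<Omega> \<and>
     (\<forall>\<phi>\<in>test_functions \<Omega>. L2_inner \<Omega> v (grad \<phi>) = - L2_inner_scalar \<Omega> d \<phi>)"

text \<open>On open sets weak derivatives are unique up to null sets.\<close>

definition weak_grad :: "(real^3) set \<Rightarrow> (real^3 \<Rightarrow> complex) \<Rightarrow> real^3 \<Rightarrow> complex^3" where
  "weak_grad \<Omega> u = (SOME g. has_weak_grad \<Omega> u g)"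

definition weak_curl :: "(real^3) set \<Rightarrow> (real^3 \<Rightarrow> complex^3) \<Rightarrow> real^3 \<Rightarrow> complex^3" where
  "weak_curl \<Omega> v = (SOME g. has_weak_curl \<Omega> v g)"

definition weak_div :: "(real^3) set \<Rightarrow> (real^3 \<Rightarrow> complex^3) \<Rightarrow> real^3 \<Rightarrow> complex" where
  "weak_div \<Omega> v = (SOME d. has_weak_div \<Omega> v d)"

definition weak_jacobian :: "(real^3) set \<Rightarrow> (real^3 \<Rightarrow> complex^3) \<Rightarrow> real^3 \<Rightarrow> complex^3^3" where
  "weak_jacobian \<Omega> z x = (\<chi> i. weak_grad \<Omega> (\<lambda>y. z y $ i) x)"

text \<open>The spaces with vanishing trace, tangential trace and normal trace are the closures of the
  test functions in the respective graph norms.\<close>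

definition H10 :: "(real^3) set \<Rightarrow> (real^3 \<Rightarrow> complex) set" where
  "H10 \<Omega> = {u \<in> L2 \<Omega>. (\<exists>g. has_weak_grad \<Omega> u g) \<and>
     (\<forall>e>0. \<exists>\<phi>\<in>test_functions \<Omega>. L2_norm \<Omega> (\<lambda>x. u x - \<phi> x) < e \<and>
        L2_norm \<Omega> (\<lambda>x. weak_grad \<Omega> u x - grad \<phi> x) < e)}"

definition H10_vec :: "(real^3) set \<Rightarrow> (real^3 \<Rightarrow> complex^3) set" where
  "H10_vec \<Omega> = {z. \<forall>i. (\<lambda>x. z x $ i) \<in> H10 \<Omega>}"

definition H0_curl :: "(real^3) set \<Rightarrow> (real^3 \<Rightarrow> complex^3) set" where
  "H0_curl \<Omega> = {v \<in> L2 \<Omega>. (\<exists>g. has_weak_curl \<Omega> v g) \<and>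
     (\<forall>e>0. \<exists>\<phi>\<in>test_functions \<Omega>. L2_norm \<Omega> (\<lambda>x. v x - \<phi> x) < e \<and>
        L2_norm \<Omega> (\<lambda>x. weak_curl \<Omega> v x - curl \<phi> x) < e)}"

definition H0_div :: "(real^3) set \<Rightarrow> (real^3 \<Rightarrow> complex^3) set" where
  "H0_div \<Omega> = {v \<in> L2 \<Omega>. (\<exists>d. has_weak_div \<Omega> v d) \<and>
     (\<forall>e>0. \<exists>\<phi>\<in>test_functions \<Omega>. L2_norm \<Omega> (\<lambda>x. v x - \<phi> x) < e \<and>
        L2_norm \<Omega> (\<lambda>x. weak_div \<Omega> v x - divergence \<phi> x) < e)}"

definition curl_inner ::
  "(real^3) set \<Rightarrow> real \<Rightarrow> (real^3 \<Rightarrow> complex^3) \<Rightarrow> (real^3 \<Rightarrow> complex^3) \<Rightarrow> complex" where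
  "curl_inner \<Omega> \<omega> v w =
     L2_inner \<Omega> (weak_curl \<Omega> v) (weak_curl \<Omega> w) + complex_of_real (\<omega>\<^sup>2) * L2_inner \<Omega> v w"

definition curl_norm :: "(real^3) set \<Rightarrow> real \<Rightarrow> (real^3 \<Rightarrow> complex^3) \<Rightarrow> real" where
  "curl_norm \<Omega> \<omega> v = sqrt (Re (curl_inner \<Omega> \<omega> v v))"


section \<open>Domain, coefficients and sesquilinear form\<close>

text \<open>Near each boundary point the set is, in the direction \<open>e\<close>, the strict epigraph of a Lipschitz
  function \<open>g\<close> that depends only on the component orthogonal to \<open>e\<close>.\<close>

definition lipschitz_boundary :: "(real^3) set \<Rightarrow> bool" where
  "lipschitz_boundary \<Omega> \<longleftrightarrow> (\<forall>p\<in>frontier \<Omega>. \<exists>e r L (g :: real^3 \<Rightarrow> real).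
     norm e = 1 \<and> r > 0 \<and> L-lipschitz_on UNIV g \<and>
     (\<forall>x\<in>ball p r. x \<in> \<Omega> \<longleftrightarrow> x \<bullet> e > g (x - (x \<bullet> e) *\<^sub>R e)))"

definition polyhedral_boundary :: "(real^3) set \<Rightarrow> bool" where
  "polyhedral_boundary \<Omega> \<longleftrightarrow>
     (\<exists>F. finite F \<and> (\<forall>f\<in>F. polytope f \<and> aff_dim f \<le> 2) \<and> frontier \<Omega> = \<Union>F)"

definition admissible_domain :: "(real^3) set \<Rightarrow> bool" where
  "admissible_domain \<Omega> \<longleftrightarrow> open \<Omega> \<and> bounded \<Omega> \<and> \<Omega> \<noteq> {} \<and> contractible \<Omega> \<and>
     lipschitz_boundary \<Omega> \<and> polyhedral_boundary \<Omega>"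

definition elliptic_coefficient ::
  "(real^3) set \<Rightarrow> real \<Rightarrow> real \<Rightarrow> (real^3 \<Rightarrow> real^3^3) \<Rightarrow> bool" where
  "elliptic_coefficient \<Omega> a M A \<longleftrightarrow> A \<in> borel_measurable (lebesgue_on \<Omega>) \<and>
     (AE x in lebesgue_on \<Omega>. \<forall>\<xi>. norm (A x *v \<xi>) \<le> M * norm \<xi> \<and> a * (norm \<xi>)\<^sup>2 \<le> (A x *v \<xi>) \<bullet> \<xi>)"

definition real_matrix_mult :: "real^3^3 \<Rightarrow> complex^3 \<Rightarrow> complex^3" where
  "real_matrix_mult A v = (\<chi> i. \<Sum>j\<in>UNIV. complex_of_real (A $ i $ j) * v $ j)"

definition B_form :: "(real^3) set \<Rightarrow> (real^3 \<Rightarrow> real^3^3) \<Rightarrow> (real^3 \<Rightarrow> real^3^3) \<Rightarrow> real \<Rightarrow>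
    (real^3 \<Rightarrow> complex^3) \<Rightarrow> (real^3 \<Rightarrow> complex^3) \<Rightarrow> complex" where
  "B_form \<Omega> \<mu> \<epsilon> \<omega> v \<psi> =
     L2_inner \<Omega> (\<lambda>x. real_matrix_mult (\<mu> x) (weak_curl \<Omega> v x)) (weak_curl \<Omega> \<psi>)
     - complex_of_real (\<omega>\<^sup>2) * L2_inner \<Omega> (\<lambda>x. real_matrix_mult (\<epsilon> x) (v x)) \<psi>"

definition uniquely_solvable ::
  "(real^3) set \<Rightarrow> (real^3 \<Rightarrow> real^3^3) \<Rightarrow> (real^3 \<Rightarrow> real^3^3) \<Rightarrow> real \<Rightarrow> bool" where
  "uniquely_solvable \<Omega> \<mu> \<epsilon> \<omega> \<longleftrightarrow> (\<forall>f\<in>L2 \<Omega>.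
     (\<exists>u\<in>H0_curl \<Omega>. \<forall>\<psi>\<in>H0_curl \<Omega>. B_form \<Omega> \<mu> \<epsilon> \<omega> u \<psi> = L2_inner \<Omega> f \<psi>) \<and>
     (\<forall>u\<in>H0_curl \<Omega>. \<forall>u'\<in>H0_curl \<Omega>.
        (\<forall>\<psi>\<in>H0_curl \<Omega>. B_form \<Omega> \<mu> \<epsilon> \<omega> u \<psi> = L2_inner \<Omega> f \<psi>) \<and>
        (\<forall>\<psi>\<in>H0_curl \<Omega>. B_form \<Omega> \<mu> \<epsilon> \<omega> u' \<psi> = L2_inner \<Omega> f \<psi>) \<longrightarrow> ae_eq \<Omega> u u'))"


section \<open>Meshes and finite element spaces\<close>

definition mesh_size :: "(real^3) set set \<Rightarrow> real" where
  "mesh_size \<T> = Max (diameter ` \<T>)"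

definition admissible_mesh :: "(real^3) set \<Rightarrow> real \<Rightarrow> real \<Rightarrow> (real^3) set set \<Rightarrow> bool" where
  "admissible_mesh \<Omega> \<sigma> \<tau> \<T> \<longleftrightarrow> triangulation \<T> \<and> (\<forall>T\<in>\<T>. 3 simplex T) \<and> \<Union>\<T> = closure \<Omega> \<and>
     (\<forall>T\<in>\<T>. \<exists>x r. r > 0 \<and> ball x r \<subseteq> T \<and> diameter T \<le> \<sigma> * r) \<and>
     (\<forall>T\<in>\<T>. mesh_size \<T> \<le> \<tau> * diameter T)"

definition patch :: "(real^3) set set \<Rightarrow> (real^3) set \<Rightarrow> (real^3) set" where
  "patch \<T> G = interior (\<Union>{T\<in>\<T>. T \<inter> closure G \<noteq> {}})"

definition complex_vec :: "real^3 \<Rightarrow> complex^3" where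
  "complex_vec x = (\<chi> i. complex_of_real (x $ i))"

definition complex_cross :: "complex^3 \<Rightarrow> complex^3 \<Rightarrow> complex^3" where
  "complex_cross a b = vector
     [a $ 2 * b $ 3 - a $ 3 * b $ 2, a $ 3 * b $ 1 - a $ 1 * b $ 3, a $ 1 * b $ 2 - a $ 2 * b $ 1]"

definition nedelec :: "(real^3) set \<Rightarrow> (real^3) set set \<Rightarrow> (real^3 \<Rightarrow> complex^3) set" where
  "nedelec \<Omega> \<T> = {v \<in> H0_curl \<Omega>. \<forall>T\<in>\<T>. \<exists>a b.
     AE x in lebesgue_on T. v x = complex_cross a (complex_vec x) + b}"

definition lagrange :: "(real^3) set \<Rightarrow> (real^3) set set \<Rightarrow> (real^3 \<Rightarrow> complex) set" where
  "lagrange \<Omega> \<T> = {u \<in> H10 \<Omega>. \<exists>p. continuous_on (closure \<Omega>) p \<and> ae_eq \<Omega> u p \<and>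
     (\<forall>T\<in>\<T>. \<exists>(a::complex^3) b. \<forall>x\<in>T. p x = (\<Sum>i\<in>UNIV. a $ i * complex_vec x $ i) + b)}"

definition raviart_thomas :: "(real^3) set \<Rightarrow> (real^3) set set \<Rightarrow> (real^3 \<Rightarrow> complex^3) set" where
  "raviart_thomas \<Omega> \<T> = {v \<in> H0_div \<Omega>. \<forall>T\<in>\<T>. \<exists>a b.
     AE x in lebesgue_on T. v x = a *s complex_vec x + b}"


section \<open>Interpolation and regular decomposition\<close>

text \<open>\<open>P\<close> is a complex-linear projection from \<open>X\<close> onto \<open>Y\<close>, up to null sets. The argument \<open>sc\<close> is the
  multiplication by complex scalars in the codomain of the functions.\<close>

definition linear_projection :: "(real^3) set \<Rightarrow> (complex \<Rightarrow> 'b \<Rightarrow> 'b) \<Rightarrow>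
    (real^3 \<Rightarrow> 'b::ab_group_add) set \<Rightarrow> (real^3 \<Rightarrow> 'b) set \<Rightarrow> ((real^3 \<Rightarrow> 'b) \<Rightarrow> real^3 \<Rightarrow> 'b) \<Rightarrow> bool" where
  "linear_projection \<Omega> sc X Y P \<longleftrightarrow>
     (\<forall>v\<in>X. P v \<in> Y) \<and>
     (\<forall>v\<in>X. \<forall>w\<in>X. ae_eq \<Omega> v w \<longrightarrow> ae_eq \<Omega> (P v) (P w)) \<and>
     (\<forall>v\<in>X. \<forall>w\<in>X. ae_eq \<Omega> (P (\<lambda>x. v x + w x)) (\<lambda>x. P v x + P w x)) \<and>
     (\<forall>c. \<forall>v\<in>X. ae_eq \<Omega> (P (\<lambda>x. sc c (v x))) (\<lambda>x. sc c (P v x))) \<and>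
     (\<forall>v\<in>Y. ae_eq \<Omega> (P v) v)"

text \<open>The explicit construction of the Falk--Winther edge interpolation is not reproduced; the predicate
  collects its properties as a local bounded cochain projection: it is the edge part of a cochain map
  of projections onto the lowest-order spaces and is locally stable with constant \<open>K\<close>.\<close>

definition falk_winther_interpolation ::
  "(real^3) set \<Rightarrow> (real^3) set set \<Rightarrow> real \<Rightarrow> ((real^3 \<Rightarrow> complex^3) \<Rightarrow> real^3 \<Rightarrow> complex^3) \<Rightarrow> bool" where
  "falk_winther_interpolation \<Omega> \<T> K \<pi>E \<longleftrightarrow>
     linear_projection \<Omega> (*s) (H0_curl \<Omega>) (nedelec \<Omega> \<T>) \<pi>E \<and>
     (\<exists>\<pi>V \<pi>F. linear_projection \<Omega> (*) (H10 \<Omega>) (lagrange \<Omega> \<T>) \<pi>V \<and>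
        linear_projection \<Omega> (*s) (H0_div \<Omega>) (raviart_thomas \<Omega> \<T>) \<pi>F \<and>
        (\<forall>\<theta>\<in>H10 \<Omega>. ae_eq \<Omega> (\<pi>E (weak_grad \<Omega> \<theta>)) (weak_grad \<Omega> (\<pi>V \<theta>))) \<and>
        (\<forall>v\<in>H0_curl \<Omega>. ae_eq \<Omega> (weak_curl \<Omega> (\<pi>E v)) (\<pi>F (weak_curl \<Omega> v)))) \<and>
     (\<forall>v\<in>H0_curl \<Omega>. \<forall>T\<in>\<T>.
        L2_norm T (\<pi>E v) \<le>
          K * (L2_norm (patch \<T> T) v + mesh_size \<T> * L2_norm (patch \<T> T) (weak_curl \<Omega> v)) \<and>
        L2_norm T (weak_curl \<Omega> (\<pi>E v)) \<le> K * L2_norm (patch \<T> T) (weak_curl \<Omega> v))"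

definition interpolation_kernel ::
  "(real^3) set \<Rightarrow> ((real^3 \<Rightarrow> complex^3) \<Rightarrow> real^3 \<Rightarrow> complex^3) \<Rightarrow> (real^3 \<Rightarrow> complex^3) set" where
  "interpolation_kernel \<Omega> \<pi>E = {w \<in> H0_curl \<Omega>. ae_eq \<Omega> (\<pi>E w) (\<lambda>x. 0)}"

definition nonzero_kernel ::
  "(real^3) set \<Rightarrow> ((real^3 \<Rightarrow> complex^3) \<Rightarrow> real^3 \<Rightarrow> complex^3) \<Rightarrow> (real^3 \<Rightarrow> complex^3) set" where
  "nonzero_kernel \<Omega> \<pi>E = {w \<in> interpolation_kernel \<Omega> \<pi>E. \<not> ae_eq \<Omega> w (\<lambda>x. 0)}"

definition regular_decomposition :: "(real^3) set \<Rightarrow> (real^3) set set \<Rightarrow> real \<Rightarrow>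
    ((real^3 \<Rightarrow> complex^3) \<Rightarrow> real^3 \<Rightarrow> complex^3) \<Rightarrow>
    (real^3 \<Rightarrow> complex^3) \<Rightarrow> (real^3 \<Rightarrow> complex^3) \<Rightarrow> (real^3 \<Rightarrow> complex) \<Rightarrow> bool" where
  "regular_decomposition \<Omega> \<T> K \<pi>E v z \<theta> \<longleftrightarrow>
     z \<in> H10_vec \<Omega> \<and> \<theta> \<in> H10 \<Omega> \<and>
     ae_eq \<Omega> (\<lambda>x. v x - \<pi>E v x) (\<lambda>x. z x + weak_grad \<Omega> \<theta> x) \<and>
     (\<forall>T\<in>\<T>. let N3 = (patch \<T> ^^ 3) T; H = mesh_size \<T> in
        inverse H * L2_norm T z + L2_norm T (weak_jacobian \<Omega> z) \<le> K * L2_norm N3 (weak_curl \<Omega> v) \<and>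
        inverse H * L2_norm T \<theta> + L2_norm T (weak_grad \<Omega> \<theta>) \<le>
          K * (L2_norm N3 v + H * L2_norm N3 (weak_curl \<Omega> v)))"

definition triple_norm ::
  "(real^3) set \<Rightarrow> real \<Rightarrow> (real^3 \<Rightarrow> complex^3) \<Rightarrow> (real^3 \<Rightarrow> complex) \<Rightarrow> real" where
  "triple_norm \<Omega> \<omega> z \<theta> =
     sqrt ((L2_norm \<Omega> (weak_curl \<Omega> z))\<^sup>2 + \<omega>\<^sup>2 * (L2_norm \<Omega> (weak_grad \<Omega> \<theta>))\<^sup>2)"

end

theory Submission
  imports Defs
begin

text \<open>Let \<open>w = z + \<nabla>\<theta>\<close> lie in the kernel of \<open>\<pi>E\<close>. Adding gradients changes no curl, so
  \<open>curl z = curl w\<close>, and summing the local bounds over the mesh (whose patches overlap a bounded number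
  of times) gives \<open>\<parallel>z\<parallel> \<lesssim> H \<parallel>curl w\<parallel>\<close>. Under the resolution condition \<open>z\<close> is therefore
  negligible in the weighted norm, which is part (i). For part (ii) the test field is
  \<open>\<phi> = 2 (z - \<pi>E z) - w\<close>. Since \<open>\<pi>E w = 0\<close>, the commuting diagram makes \<open>\<pi>E z\<close> a gradient; hence
  \<open>curl \<phi> = curl w\<close>, while \<open>\<phi>\<close> equals \<open>- w\<close> up to a field of size \<open>H \<parallel>curl w\<parallel>\<close>. The sign flip turns
  the indefinite form into \<open>(\<mu> curl w, curl w) + \<omega>\<^sup>2 (\<epsilon> w, w)\<close> up to a small perturbation.\<close>

section \<open>Calculus of test functions\<close>

text \<open>The natural candidate for reversing the sign of the gradient part is z -
  \<nabla>\<theta> = 2 z - w, but it need not lie in the kernel. Replacing z by z - \<pi>E z repairs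
  this, because the identity minus a projection maps into the kernel, and the price is the size of
  \<pi>E z, again of order H by local stability.

  Fields are representatives and weak derivatives are picked by Hilbert choice, so identities such
  as curl z = curl w must be shown through the relation \<open>has_weak_curl\<close>. They are all
  reduced to one situation: a multiple of a weak gradient is added to a field already known to be in
  \<open>H0_curl\<close>. In particular z enters that space as w - \<nabla>\<theta>.

  Estimates are kept in squared form: squares add up over cells, and the pointwise bound of |a +
  b|^2 by 2 |a|^2 + 2 |b|^2 replaces the triangle inequality. This is the source of most factors 2,
  4 and 8 in the constants.

  Smallness of \<omega> H beyond \<omega> H \<le> 1 serves only part (ii). There Young's inequality
  with a weight d splits the perturbation: d makes its w-part at most half of the \<epsilon>-term,
  and then c0 makes the rest at most half of the \<mu>-term.\<close>

lemma partial_has_vector_derivative: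
  assumes "f differentiable_on UNIV"
  shows "((\<lambda>s. f (x + s *\<^sub>R axis i 1)) has_vector_derivative partial i f (x + s *\<^sub>R axis i 1)) (at s)"
proof -
  have "(f has_derivative frechet_derivative f (at (x + s *\<^sub>R axis i 1))) (at (x + s *\<^sub>R axis i 1))"
    using assms frechet_derivative_works by (auto simp: differentiable_on_def)
  moreover have "((\<lambda>s. x + s *\<^sub>R axis i 1) has_vector_derivative axis i 1) (at s)"
    by (auto intro!: derivative_eq_intros simp: has_vector_derivative_def)
  ultimately have "(f \<circ> (\<lambda>s. x + s *\<^sub>R axis i 1) has_vector_derivative
      frechet_derivative f (at (x + s *\<^sub>R axis i 1)) (axis i 1)) (at s)"
    using vector_derivative_diff_chain_within has_derivative_at_withinI by blast
  then show ?thesis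
    by (simp add: partial_def o_def)
qed

lemma partial_eqI:
  assumes "(f has_derivative f') (at x)"
  shows "partial i f x = f' (axis i 1)"
  using frechet_derivative_at[OF assms] by (simp add: partial_def)

lemma partial_compose_linear:
  assumes "bounded_linear L" "f differentiable_on UNIV"
  shows "partial i (\<lambda>x. L (f x)) = (\<lambda>x. L (partial i f x))"
proof
  fix x
  have "(f has_derivative frechet_derivative f (at x)) (at x)"
    using assms frechet_derivative_works by (auto simp: differentiable_on_def)
  then have "((\<lambda>x. L (f x)) has_derivative (\<lambda>h. L (frechet_derivative f (at x) h))) (at x)"
    by (rule bounded_linear.has_derivative[OF assms(1)])
  then show "partial i (\<lambda>x. L (f x)) x = L (partial i f x)"
    by (rule partial_eqI[THEN trans]) (simp add: partial_def)
qed

lemma partial_add: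
  assumes "f differentiable_on UNIV" "g differentiable_on UNIV"
  shows "partial i (\<lambda>x. f x + g x) = (\<lambda>x. partial i f x + partial i g x)"
proof
  fix x
  have "((\<lambda>x. f x + g x) has_derivative
      (\<lambda>h. frechet_derivative f (at x) h + frechet_derivative g (at x) h)) (at x)"
    using assms frechet_derivative_works by (auto simp: differentiable_on_def intro!: has_derivative_add)
  then show "partial i (\<lambda>x. f x + g x) x = partial i f x + partial i g x"
    by (rule partial_eqI[THEN trans]) (simp add: partial_def)
qed

lemma times_cont_diff_compose_linear:
  assumes "bounded_linear L"
  shows "times_cont_diff k f \<Longrightarrow> times_cont_diff k (\<lambda>x. L (f x))"
proof (induction k arbitrary: f)
  case 0
  then show ?case
    using bounded_linear.continuous_on[OF assms] by simp
next
  case (Suc k)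
  then have "(\<lambda>x. L (f x)) differentiable_on UNIV"
    using bounded_linear.has_derivative[OF assms] by (auto simp: differentiable_on_def differentiable_def) blast
  with Suc show ?case
    by (simp add: partial_compose_linear[OF assms])
qed

lemma times_cont_diff_add:
  "times_cont_diff k f \<Longrightarrow> times_cont_diff k g \<Longrightarrow> times_cont_diff k (\<lambda>x. f x + g x)"
  by (induction k arbitrary: f g) (auto intro: continuous_on_add simp: partial_add)

definition smooth :: "(real^3 \<Rightarrow> 'b::real_normed_vector) \<Rightarrow> bool" where
  "smooth f \<longleftrightarrow> (\<forall>k. times_cont_diff k f)"

lemma smooth_differentiable: "smooth f \<Longrightarrow> f differentiable_on UNIV"
  unfolding smooth_def by (metis times_cont_diff.simps(2))

lemma smooth_partial: "smooth f \<Longrightarrow> smooth (partial i f)"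
  unfolding smooth_def by (metis times_cont_diff.simps(2))

lemma smooth_continuous: "smooth f \<Longrightarrow> continuous_on UNIV f"
  unfolding smooth_def by (metis times_cont_diff.simps(1))

lemma smooth_compose_linear: "bounded_linear L \<Longrightarrow> smooth f \<Longrightarrow> smooth (\<lambda>x. L (f x))"
  by (simp add: smooth_def times_cont_diff_compose_linear)

lemma smooth_add: "smooth f \<Longrightarrow> smooth g \<Longrightarrow> smooth (\<lambda>x. f x + g x)"
  by (simp add: smooth_def times_cont_diff_add)

lemma smooth_diff:
  assumes "smooth f" "smooth g"
  shows "smooth (\<lambda>x. f x - g x)"
  using smooth_add[OF assms(1) smooth_compose_linear[OF bounded_linear_minus[OF bounded_linear_ident] assms(2)]]
  by simp

lemma smooth_component: "smooth f \<Longrightarrow> smooth (\<lambda>x. f x $ i)" for f :: "real^3 \<Rightarrow> complex^3"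
  by (rule smooth_compose_linear) (rule bounded_linear_vec_nth)

lemma norm_axis_complex: "norm (axis i x :: complex^3) = norm x"
proof -
  have "(\<Sum>j\<in>UNIV. (norm (axis i x $ j))\<^sup>2) = (\<Sum>j\<in>UNIV. if j = i then (norm x)\<^sup>2 else 0)"
    by (intro sum.cong) (auto simp: axis_def)
  then show ?thesis
    by (simp add: norm_vec_def L2_set_def)
qed

lemma bounded_linear_axis: "bounded_linear (axis i :: complex \<Rightarrow> complex^3)"
  by (rule bounded_linear_intro[where K=1]) (simp_all add: norm_axis_complex, simp_all add: axis_def vec_eq_iff)

text \<open>The vector is rebuilt as a sum of coordinate embeddings, so that stability of smoothness
  under sums and bounded linear maps is enough.\<close>

lemma smooth_vecI:
  fixes f :: "real^3 \<Rightarrow> complex^3"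
  assumes "\<And>i. smooth (\<lambda>x. f x $ i)"
  shows "smooth f"
proof -
  have "smooth (\<lambda>x. axis 1 (f x $ 1) + (axis 2 (f x $ 2) + axis 3 (f x $ 3)) :: complex^3)"
    by (intro smooth_add smooth_compose_linear[OF bounded_linear_axis] assms)
  also have "(\<lambda>x. axis 1 (f x $ 1) + (axis 2 (f x $ 2) + axis 3 (f x $ 3)) :: complex^3) = f"
    by (auto simp: vec_eq_iff axis_def forall_3)
  finally show ?thesis .
qed

text \<open>The mean value theorem is applied twice: along i to the difference \<open>u\<close> of f
  on two parallel lines, then along j to \<open>partial i f\<close>. The left side is symmetric in i
  and j, while the right side shows one order of differentiation.\<close>

lemma second_difference_mvt:
  fixes f :: "real^3 \<Rightarrow> real"
  assumes "f differentiable_on UNIV" "partial i f differentiable_on UNIV" "h > 0"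
  obtains s t where "0 < s" "s < h" "0 < t" "t < h"
    "f (x + h *\<^sub>R axis i 1 + h *\<^sub>R axis j 1) - f (x + h *\<^sub>R axis i 1) - f (x + h *\<^sub>R axis j 1) + f x
      = h * (h * partial j (partial i f) (x + s *\<^sub>R axis i 1 + t *\<^sub>R axis j 1))"
proof -
  define u where "u s = f (x + h *\<^sub>R axis j 1 + s *\<^sub>R axis i 1) - f (x + s *\<^sub>R axis i 1)" for s
  have "\<exists>s>0. s < h \<and> u h - u 0 = (h - 0) *
      (\<lambda>s. partial i f (x + h *\<^sub>R axis j 1 + s *\<^sub>R axis i 1) - partial i f (x + s *\<^sub>R axis i 1)) s"
  proof (rule MVT2[OF \<open>h > 0\<close>])
    show "DERIV u s :> partial i f (x + h *\<^sub>R axis j 1 + s *\<^sub>R axis i 1) - partial i f (x + s *\<^sub>R axis i 1)" for s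
      unfolding u_def using partial_has_vector_derivative[OF assms(1)]
      by (intro DERIV_diff) (simp_all add: has_real_derivative_iff_has_vector_derivative)
  qed
  then obtain s where s: "0 < s" "s < h"
    "u h - u 0 = (h - 0) * (partial i f (x + h *\<^sub>R axis j 1 + s *\<^sub>R axis i 1) - partial i f (x + s *\<^sub>R axis i 1))"
    by auto
  define v where "v t = partial i f (x + s *\<^sub>R axis i 1 + t *\<^sub>R axis j 1)" for t
  have "\<exists>t>0. t < h \<and> v h - v 0 = (h - 0) *
      (\<lambda>t. partial j (partial i f) (x + s *\<^sub>R axis i 1 + t *\<^sub>R axis j 1)) t"
  proof (rule MVT2[OF \<open>h > 0\<close>])
    show "DERIV v t :> partial j (partial i f) (x + s *\<^sub>R axis i 1 + t *\<^sub>R axis j 1)" for t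
      unfolding v_def using partial_has_vector_derivative[OF assms(2)]
      by (simp add: has_real_derivative_iff_has_vector_derivative)
  qed
  then obtain t where t: "0 < t" "t < h"
    "v h - v 0 = h * partial j (partial i f) (x + s *\<^sub>R axis i 1 + t *\<^sub>R axis j 1)"
    by auto
  show ?thesis
    using that[OF s(1,2) t(1,2)] s(3) t(3) by (simp add: u_def v_def algebra_simps)
qed

text \<open>Both mixed derivatives represent the same second difference, so they agree at two points
  arbitrarily close to x. Continuity then excludes different values at x.\<close>

lemma partial_commute_real:
  fixes f :: "real^3 \<Rightarrow> real"
  assumes "smooth f"
  shows "partial i (partial j f) x = partial j (partial i f) x"
proof (rule ccontr)
  define P where "P = partial i (partial j f)"
  define Q where "Q = partial j (partial i f)"
  assume "\<not> ?thesis"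
  then have e: "dist (P x) (Q x) / 2 > 0" (is "?e > 0")
    by (simp add: P_def Q_def)
  have "isCont P x" "isCont Q x"
    using smooth_continuous[OF smooth_partial[OF smooth_partial[OF assms]]]
    by (auto simp: P_def Q_def continuous_on_eq_continuous_at)
  then obtain d1 d2 where d: "d1 > 0" "d2 > 0" "\<And>y. dist y x < d1 \<Longrightarrow> dist (P y) (P x) < ?e"
    "\<And>y. dist y x < d2 \<Longrightarrow> dist (Q y) (Q x) < ?e"
    using e unfolding continuous_at_eps_delta by metis
  \<comment> \<open>Half of the radius, because the evaluation point is displaced by up to s + t < 2
    h.\<close>
  define h where "h = min d1 d2 / 2"
  have h: "h > 0" using d by (simp add: h_def)
  have D: "dist (x + s *\<^sub>R axis k 1 + t *\<^sub>R axis l 1) x < min d1 d2"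
    if "0 < s" "s < h" "0 < t" "t < h" for s t and k l :: 3
  proof -
    have "dist (x + s *\<^sub>R axis k 1 + t *\<^sub>R axis l 1) x = norm (s *\<^sub>R axis k 1 + t *\<^sub>R axis l 1 :: real^3)"
      by (simp add: dist_norm)
    also have "\<dots> \<le> s + t"
      using that norm_triangle_ineq[of "s *\<^sub>R axis k 1" "t *\<^sub>R axis l 1 :: real^3"] by simp
    finally show ?thesis
      using that by (simp add: h_def)
  qed
  obtain s t where st: "0 < s" "s < h" "0 < t" "t < h"
    "f (x + h *\<^sub>R axis i 1 + h *\<^sub>R axis j 1) - f (x + h *\<^sub>R axis i 1) - f (x + h *\<^sub>R axis j 1) + f x
      = h * (h * Q (x + s *\<^sub>R axis i 1 + t *\<^sub>R axis j 1))"
    unfolding Q_def using assms h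
    by (metis second_difference_mvt smooth_differentiable smooth_partial)
  obtain s' t' where st': "0 < s'" "s' < h" "0 < t'" "t' < h"
    "f (x + h *\<^sub>R axis j 1 + h *\<^sub>R axis i 1) - f (x + h *\<^sub>R axis j 1) - f (x + h *\<^sub>R axis i 1) + f x
      = h * (h * P (x + s' *\<^sub>R axis j 1 + t' *\<^sub>R axis i 1))"
    unfolding P_def using assms h
    by (metis second_difference_mvt smooth_differentiable smooth_partial)
  have "h * (h * P (x + s' *\<^sub>R axis j 1 + t' *\<^sub>R axis i 1)) = h * (h * Q (x + s *\<^sub>R axis i 1 + t *\<^sub>R axis j 1))"
    unfolding st(5)[symmetric] st'(5)[symmetric] by (simp add: add.commute add.left_commute)
  then have eq: "P (x + s' *\<^sub>R axis j 1 + t' *\<^sub>R axis i 1) = Q (x + s *\<^sub>R axis i 1 + t *\<^sub>R axis j 1)"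
    using h by simp
  have "dist (P (x + s' *\<^sub>R axis j 1 + t' *\<^sub>R axis i 1)) (P x) < ?e"
    "dist (Q (x + s *\<^sub>R axis i 1 + t *\<^sub>R axis j 1)) (Q x) < ?e"
    using d(3,4) D st(1-4) st'(1-4) by force+
  then show False
    unfolding eq by (smt (verit) dist_commute dist_triangle field_sum_of_halves)
qed

text \<open>The mean value theorem needs real values, hence the passage through real and imaginary
  parts.\<close>

lemma partial_commute:
  fixes f :: "real^3 \<Rightarrow> complex"
  assumes "smooth f"
  shows "partial i (partial j f) x = partial j (partial i f) x"
proof -
  have "L (partial i (partial j f) x) = L (partial j (partial i f) x)"
    if L: "bounded_linear L" for L :: "complex \<Rightarrow> real"
    using partial_commute_real[OF smooth_compose_linear[OF L assms], of i j x]
    by (simp add: partial_compose_linear[OF L] smooth_differentiable smooth_partial assms)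
  from this[OF bounded_linear_Re] this[OF bounded_linear_Im] show ?thesis
    by (rule complex_eqI)
qed

section \<open>Identities for curl, gradient and divergence; stability of test functions\<close>

lemma curl_nth:
  "curl f x $ 1 = partial 2 (\<lambda>y. f y $ 3) x - partial 3 (\<lambda>y. f y $ 2) x"
  "curl f x $ 2 = partial 3 (\<lambda>y. f y $ 1) x - partial 1 (\<lambda>y. f y $ 3) x"
  "curl f x $ 3 = partial 1 (\<lambda>y. f y $ 2) x - partial 2 (\<lambda>y. f y $ 1) x"
  by (simp_all add: curl_def)

lemma smooth_curl:
  assumes "smooth f"
  shows "smooth (curl f)"
proof (rule smooth_vecI)
  show "smooth (\<lambda>x. curl f x $ i)" for i
    using exhaust_3[of i] smooth_diff[OF smooth_partial[OF smooth_component[OF assms]] smooth_partial[OF smooth_component[OF assms]]]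
    by (auto simp: curl_nth)
qed

lemma smooth_grad:
  assumes "smooth f"
  shows "smooth (grad f)"
  by (rule smooth_vecI) (simp add: grad_def smooth_partial assms)

lemma partial_diff:
  assumes "f differentiable_on UNIV" "g differentiable_on UNIV"
  shows "partial i (\<lambda>x. f x - g x) = (\<lambda>x. partial i f x - partial i g x)"
proof
  fix x
  have "((\<lambda>x. f x - g x) has_derivative
      (\<lambda>h. frechet_derivative f (at x) h - frechet_derivative g (at x) h)) (at x)"
    using assms frechet_derivative_works by (auto simp: differentiable_on_def intro!: has_derivative_diff)
  then show "partial i (\<lambda>x. f x - g x) x = partial i f x - partial i g x"
    by (rule partial_eqI[THEN trans]) (simp add: partial_def)
qed

text \<open>Used with curls as test fields: it makes a weak gradient orthogonal to every curl of a
  test function.\<close>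

lemma divergence_curl:
  assumes "smooth f"
  shows "divergence (curl f) x = 0"
  using partial_commute[OF smooth_component[OF assms]]
  by (simp add: divergence_def sum_3 curl_nth partial_diff smooth_differentiable smooth_partial
      smooth_component assms)

text \<open>Used on the approximating side: correcting a test function by a classical gradient
  leaves its curl unchanged.\<close>

lemma curl_grad:
  assumes "smooth f"
  shows "curl (grad f) x = 0"
  using partial_commute[OF assms]
  by (simp add: vec_eq_iff forall_3 curl_nth) (simp add: grad_def)

lemma curl_add_scaleR:
  assumes "smooth f" "smooth g"
  shows "curl (\<lambda>x. f x + c *\<^sub>R g x) x = curl f x + c *\<^sub>R curl g x"
proof -
  have "partial i (\<lambda>x. (f x + c *\<^sub>R g x) $ j) = (\<lambda>x. partial i (\<lambda>y. f y $ j) x + c *\<^sub>R partial i (\<lambda>y. g y $ j) x)"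
    for i j
    using assms smooth_compose_linear[OF bounded_linear_scaleR_right smooth_component[OF assms(2)]]
    by (simp add: partial_add partial_compose_linear[OF bounded_linear_scaleR_right]
        smooth_differentiable smooth_component)
  then show ?thesis
    by (simp add: vec_eq_iff forall_3 curl_nth algebra_simps)
qed

lemma test_functions_iff:
  "\<phi> \<in> test_functions \<Omega> \<longleftrightarrow>
     smooth \<phi> \<and> compact (closure {x. \<phi> x \<noteq> 0}) \<and> closure {x. \<phi> x \<noteq> 0} \<subseteq> \<Omega>"
  by (simp add: test_functions_def smooth_def)

lemma test_function_smooth: "\<phi> \<in> test_functions \<Omega> \<Longrightarrow> smooth \<phi>"
  by (simp add: test_functions_iff)

lemma test_functions_supportI:
  assumes "smooth \<psi>" "compact K" "K \<subseteq> \<Omega>" "\<And>x. x \<notin> K \<Longrightarrow> \<psi> x = 0"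
  shows "\<psi> \<in> test_functions \<Omega>"
proof -
  have "closure {x. \<psi> x \<noteq> 0} \<subseteq> K"
    using assms by (intro closure_minimal) (auto intro: compact_imp_closed)
  then show ?thesis
    using assms compact_Int_closed[of K "closure {x. \<psi> x \<noteq> 0}"]
    by (auto simp: test_functions_iff inf.absorb2)
qed

lemma partial_outside_support:
  assumes "x \<notin> closure {x. f x \<noteq> 0}"
  shows "partial i f x = 0"
proof -
  have "((\<lambda>x. 0) has_derivative (\<lambda>h. 0)) (at x)"
    by simp
  then have "(f has_derivative (\<lambda>h. 0)) (at x)"
  proof (rule has_derivative_transform_within_open)
    show "open (- closure {x. f x \<noteq> 0})" "x \<in> - closure {x. f x \<noteq> 0}"
      using assms by auto
  next
    fix y assume "y \<in> - closure {x. f x \<noteq> 0}"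
    then show "0 = f y"
      using closure_subset[of "{x. f x \<noteq> 0}"] by auto
  qed
  from partial_eqI[OF this] show ?thesis .
qed

lemma partial_component_outside_support:
  fixes f :: "real^3 \<Rightarrow> complex^3"
  assumes "x \<notin> closure {x. f x \<noteq> 0}"
  shows "partial i (\<lambda>y. f y $ j) x = 0"
proof (rule partial_outside_support)
  have "{x. f x $ j \<noteq> 0} \<subseteq> {x. f x \<noteq> 0}" by auto
  then show "x \<notin> closure {x. f x $ j \<noteq> 0}"
    using closure_mono assms by blast
qed

lemma curl_test_function:
  assumes "\<phi> \<in> test_functions \<Omega>"
  shows "curl \<phi> \<in> test_functions \<Omega>"
proof (rule test_functions_supportI[where K="closure {x. \<phi> x \<noteq> 0}"])
  show "curl \<phi> x = 0" if "x \<notin> closure {x. \<phi> x \<noteq> 0}" for x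
    using partial_component_outside_support[OF that] by (simp add: vec_eq_iff forall_3 curl_nth)
qed (use assms smooth_curl in \<open>auto simp: test_functions_iff\<close>)

lemma grad_test_function:
  assumes "\<phi> \<in> test_functions \<Omega>"
  shows "grad \<phi> \<in> test_functions \<Omega>"
proof (rule test_functions_supportI[where K="closure {x. \<phi> x \<noteq> 0}"])
  show "grad \<phi> x = 0" if "x \<notin> closure {x. \<phi> x \<noteq> 0}" for x
    using partial_outside_support[OF that] by (simp add: vec_eq_iff grad_def)
qed (use assms smooth_grad in \<open>auto simp: test_functions_iff\<close>)

lemma add_scaleR_test_function:
  assumes "\<phi> \<in> test_functions \<Omega>" "\<psi> \<in> test_functions \<Omega>"
  shows "(\<lambda>x. \<phi> x + c *\<^sub>R \<psi> x) \<in> test_functions \<Omega>"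
proof (rule test_functions_supportI[where K="closure {x. \<phi> x \<noteq> 0} \<union> closure {x. \<psi> x \<noteq> 0}"])
  show "smooth (\<lambda>x. \<phi> x + c *\<^sub>R \<psi> x)"
    using assms by (auto simp: test_functions_iff
        intro!: smooth_add smooth_compose_linear[OF bounded_linear_scaleR_right])
  show "\<phi> x + c *\<^sub>R \<psi> x = 0" if "x \<notin> closure {x. \<phi> x \<noteq> 0} \<union> closure {x. \<psi> x \<noteq> 0}" for x
  proof -
    have "\<phi> x = 0" "\<psi> x = 0"
      using that closure_subset[of "{x. \<phi> x \<noteq> 0}"] closure_subset[of "{x. \<psi> x \<noteq> 0}"] by auto
    then show ?thesis by simp
  qed
qed (use assms in \<open>auto simp: test_functions_iff\<close>)

section \<open>Square integrable functions and weak curls\<close>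

text \<open>The integrand of \<open>L2_inner\<close>, isolated so that it can be treated as a real
  bounded bilinear map. Conjugate linearity is harmless because it is combined with real scalars
  only.\<close>

definition cdot :: "complex^3 \<Rightarrow> complex^3 \<Rightarrow> complex" where
  "cdot v w = (\<Sum>i\<in>UNIV. v $ i * cnj (w $ i))"

lemma L2_inner_cdot: "L2_inner \<Omega> v w = (\<integral>x. cdot (v x) (w x) \<partial>lebesgue_on \<Omega>)"
  by (simp add: L2_inner_def cdot_def)

lemma norm_cdot_le: "norm (cdot v w) \<le> norm v * norm w"
proof -
  have "norm (cdot v w) \<le> (\<Sum>i\<in>UNIV. \<bar>cmod (v $ i)\<bar> * \<bar>cmod (w $ i)\<bar>)"
    unfolding cdot_def by (rule order_trans[OF norm_sum]) (simp add: norm_mult)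
  also have "\<dots> \<le> norm v * norm w"
    unfolding norm_vec_def by (rule L2_set_mult_ineq)
  finally show ?thesis .
qed

lemma bounded_bilinear_cdot: "bounded_bilinear cdot"
proof
  show "\<exists>K. \<forall>a b. norm (cdot a b) \<le> norm a * norm b * K"
    using norm_cdot_le by (intro exI[of _ 1]) auto
qed (simp_all add: cdot_def sum.distrib sum_subtractf algebra_simps scaleR_sum_right)

text \<open>The real part is the Euclidean inner product of complex^3 seen as a real space.
  Orthogonality and ellipticity are argued there.\<close>

lemma Re_cdot: "Re (cdot v w) = v \<bullet> w"
  by (simp add: cdot_def inner_vec_def inner_complex_def)

lemma cdot_self: "cdot v v = complex_of_real ((norm v)\<^sup>2)"
proof -
  have "(norm v)\<^sup>2 = (\<Sum>i\<in>UNIV. (cmod (v $ i))\<^sup>2)"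
    by (simp add: norm_vec_def L2_set_def sum_nonneg)
  then show ?thesis
    by (simp only: cdot_def of_real_sum complex_norm_square)
qed

text \<open>Pointwise substitute for the triangle inequality; it integrates directly to a bound on
  squared L2 norms.\<close>

lemma norm_add_power2_le:
  fixes a b :: "'a::real_normed_vector"
  shows "(norm (a + b))\<^sup>2 \<le> 2 * (norm a)\<^sup>2 + 2 * (norm b)\<^sup>2"
proof -
  have "(norm (a + b))\<^sup>2 \<le> (norm a + norm b)\<^sup>2"
    by (simp add: norm_triangle_ineq power_mono)
  also have "\<dots> \<le> 2 * (norm a)\<^sup>2 + 2 * (norm b)\<^sup>2"
    using sum_squares_bound[of "norm a" "norm b"] by (simp add: power2_sum)
  finally show ?thesis .
qed

lemma L2_measurable: "v \<in> L2 \<Omega> \<Longrightarrow> v \<in> borel_measurable (lebesgue_on \<Omega>)"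
  by (simp add: L2_def)

lemma L2_integrable: "v \<in> L2 \<Omega> \<Longrightarrow> integrable (lebesgue_on \<Omega>) (\<lambda>x. (norm (v x))\<^sup>2)"
  by (simp add: L2_def)

lemma L2_norm_nonneg [simp]: "0 \<le> L2_norm S v"
  by (simp add: L2_norm_def)

lemma L2_norm_power2: "(L2_norm S v)\<^sup>2 = (\<integral>x. (norm (v x))\<^sup>2 \<partial>lebesgue_on S)"
  by (simp add: L2_norm_def)

lemma L2_zero [simp]: "(\<lambda>x. 0) \<in> L2 \<Omega>"
  by (simp add: L2_def)

lemma L2_boundI:
  assumes "w \<in> borel_measurable (lebesgue_on \<Omega>)" "integrable (lebesgue_on \<Omega>) f"
    "AE x in lebesgue_on \<Omega>. (norm (w x))\<^sup>2 \<le> f x"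
  shows "w \<in> L2 \<Omega>"
  unfolding L2_def
proof (intro CollectI conjI assms(1))
  show "integrable (lebesgue_on \<Omega>) (\<lambda>x. (norm (w x))\<^sup>2)"
    by (rule Bochner_Integration.integrable_bound[OF assms(2)])
      (use assms in \<open>auto elim!: eventually_mono\<close>)
qed

lemma L2_add_scaleR:
  assumes "u \<in> L2 \<Omega>" "v \<in> L2 \<Omega>"
  shows "(\<lambda>x. u x + c *\<^sub>R v x) \<in> L2 \<Omega>"
proof (rule L2_boundI)
  show "integrable (lebesgue_on \<Omega>) (\<lambda>x. 2 * (norm (u x))\<^sup>2 + 2 * (c\<^sup>2 * (norm (v x))\<^sup>2))"
    using assms by (simp add: L2_def)
  show "AE x in lebesgue_on \<Omega>. (norm (u x + c *\<^sub>R v x))\<^sup>2 \<le> 2 * (norm (u x))\<^sup>2 + 2 * (c\<^sup>2 * (norm (v x))\<^sup>2)"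
    using norm_add_power2_le[of "u _" "c *\<^sub>R v _"] by (simp add: power_mult_distrib)
qed (use assms in \<open>auto simp: L2_def\<close>)

lemma L2_diff: "u \<in> L2 \<Omega> \<Longrightarrow> v \<in> L2 \<Omega> \<Longrightarrow> (\<lambda>x. u x - v x) \<in> L2 \<Omega>"
  using L2_add_scaleR[of u \<Omega> v "-1"] by simp

lemma L2_norm_add_scaleR:
  assumes "u \<in> L2 \<Omega>" "v \<in> L2 \<Omega>"
  shows "(L2_norm \<Omega> (\<lambda>x. u x + c *\<^sub>R v x))\<^sup>2 \<le> 2 * (L2_norm \<Omega> u)\<^sup>2 + 2 * (c\<^sup>2 * (L2_norm \<Omega> v)\<^sup>2)"
proof -
  have "(\<integral>x. (norm (u x + c *\<^sub>R v x))\<^sup>2 \<partial>lebesgue_on \<Omega>)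
      \<le> (\<integral>x. 2 * (norm (u x))\<^sup>2 + 2 * (c\<^sup>2 * (norm (v x))\<^sup>2) \<partial>lebesgue_on \<Omega>)"
  proof (rule integral_mono)
    show "integrable (lebesgue_on \<Omega>) (\<lambda>x. (norm (u x + c *\<^sub>R v x))\<^sup>2)"
      by (rule L2_integrable[OF L2_add_scaleR[OF assms]])
    show "integrable (lebesgue_on \<Omega>) (\<lambda>x. 2 * (norm (u x))\<^sup>2 + 2 * (c\<^sup>2 * (norm (v x))\<^sup>2))"
      using assms by (simp add: L2_def)
  qed (use norm_add_power2_le[of "u _" "c *\<^sub>R v _"] in \<open>simp add: power_mult_distrib\<close>)
  then show ?thesis
    using assms by (simp add: L2_norm_power2 L2_integrable)
qed

lemma L2_norm_cong_ae:
  assumes "u \<in> L2 \<Omega>" "v \<in> L2 \<Omega>" "ae_eq \<Omega> u v"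
  shows "L2_norm \<Omega> u = L2_norm \<Omega> v"
  unfolding L2_norm_def
proof (rule arg_cong[where f=sqrt], rule integral_cong_AE)
  show "AE x in lebesgue_on \<Omega>. (norm (u x))\<^sup>2 = (norm (v x))\<^sup>2"
    using assms(3) by (auto simp: ae_eq_def elim!: eventually_mono)
qed (use assms in \<open>auto dest: L2_measurable\<close>)

lemma L2_norm_eq_0_iff:
  assumes "v \<in> L2 \<Omega>"
  shows "L2_norm \<Omega> v = 0 \<longleftrightarrow> ae_eq \<Omega> v (\<lambda>x. 0)"
  using integral_nonneg_eq_0_iff_AE[OF L2_integrable[OF assms]] by (simp add: L2_norm_def ae_eq_def)

lemma cdot_measurable:
  assumes "u \<in> borel_measurable M" "v \<in> borel_measurable M"
  shows "(\<lambda>x. cdot (u x) (v x)) \<in> borel_measurable M"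
proof (rule borel_measurable_continuous_Pair[OF assms])
  show "continuous_on UNIV (\<lambda>x. cdot (fst x) (snd x))"
    by (rule bounded_bilinear.continuous_on[OF bounded_bilinear_cdot continuous_on_fst continuous_on_snd])
      (rule continuous_on_id)+
qed

lemma cdot_integrable:
  assumes "u \<in> L2 \<Omega>" "v \<in> L2 \<Omega>"
  shows "integrable (lebesgue_on \<Omega>) (\<lambda>x. cdot (u x) (v x))"
proof (rule Bochner_Integration.integrable_bound)
  show "integrable (lebesgue_on \<Omega>) (\<lambda>x. (norm (u x))\<^sup>2 + (norm (v x))\<^sup>2)"
    using assms by (simp add: L2_integrable)
  have "norm (cdot a b) \<le> (norm a)\<^sup>2 + (norm b)\<^sup>2" for a b
  proof -
    have "norm (cdot a b) \<le> norm a * norm b"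
      by (rule norm_cdot_le)
    also have "\<dots> \<le> (norm a)\<^sup>2 + (norm b)\<^sup>2"
      using sum_squares_bound[of "norm a" "norm b"] mult_nonneg_nonneg[OF norm_ge_zero[of a] norm_ge_zero[of b]]
      by linarith
    finally show ?thesis .
  qed
  then show "AE x in lebesgue_on \<Omega>. norm (cdot (u x) (v x)) \<le> norm ((norm (u x))\<^sup>2 + (norm (v x))\<^sup>2)"
    by simp
qed (use assms in \<open>auto intro!: cdot_measurable dest: L2_measurable\<close>)

lemma L2_inner_self:
  "L2_inner \<Omega> v v = complex_of_real ((L2_norm \<Omega> v)\<^sup>2)"
  unfolding L2_inner_cdot cdot_self L2_norm_power2 integral_complex_of_real ..

lemma L2_inner_cong_ae:
  assumes "u \<in> L2 \<Omega>" "v \<in> L2 \<Omega>" "ae_eq \<Omega> u v" "\<phi> \<in> L2 \<Omega>"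
  shows "L2_inner \<Omega> u \<phi> = L2_inner \<Omega> v \<phi>"
  unfolding L2_inner_cdot
proof (rule integral_cong_AE)
  show "AE x in lebesgue_on \<Omega>. cdot (u x) (\<phi> x) = cdot (v x) (\<phi> x)"
    using assms(3) by (auto simp: ae_eq_def elim!: eventually_mono)
qed (use assms in \<open>auto intro!: cdot_measurable dest: L2_measurable\<close>)

lemma L2_inner_add_scaleR_left:
  assumes "u \<in> L2 \<Omega>" "v \<in> L2 \<Omega>" "\<phi> \<in> L2 \<Omega>"
  shows "L2_inner \<Omega> (\<lambda>x. u x + c *\<^sub>R v x) \<phi> = L2_inner \<Omega> u \<phi> + c *\<^sub>R L2_inner \<Omega> v \<phi>"
  using assms by (simp add: L2_inner_cdot bounded_bilinear.add_left[OF bounded_bilinear_cdot]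
      bounded_bilinear.scaleR_left[OF bounded_bilinear_cdot] cdot_integrable)

lemma L2_inner_add_scaleR_right:
  assumes "u \<in> L2 \<Omega>" "v \<in> L2 \<Omega>" "\<phi> \<in> L2 \<Omega>"
  shows "L2_inner \<Omega> \<phi> (\<lambda>x. u x + c *\<^sub>R v x) = L2_inner \<Omega> \<phi> u + c *\<^sub>R L2_inner \<Omega> \<phi> v"
  using assms by (simp add: L2_inner_cdot bounded_bilinear.add_right[OF bounded_bilinear_cdot]
      bounded_bilinear.scaleR_right[OF bounded_bilinear_cdot] cdot_integrable)

lemma test_function_L2:
  fixes \<phi> :: "real^3 \<Rightarrow> 'b::euclidean_space"
  assumes "\<phi> \<in> test_functions \<Omega>" "open \<Omega>" "bounded \<Omega>"
  shows "\<phi> \<in> L2 \<Omega>"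
proof -
  have cont: "continuous_on UNIV \<phi>"
    using assms(1) by (simp add: test_functions_iff smooth_continuous)
  have "compact (\<phi> ` closure {x. \<phi> x \<noteq> 0})"
    by (rule compact_continuous_image[OF continuous_on_subset[OF cont]])
      (use assms(1) in \<open>simp_all add: test_functions_iff del: compact_closure\<close>)
  then obtain B where "norm (\<phi> x) \<le> B" if "x \<in> closure {x. \<phi> x \<noteq> 0}" for x
    by (metis compact_imp_bounded bounded_iff imageI)
  \<comment> \<open>The maximum with 0 covers points outside the support, and the zero function, for
    which \<open>B\<close> may be negative.\<close>
  then have "norm (\<phi> x) \<le> max B 0" for x
    using closure_subset[of "{x. \<phi> x \<noteq> 0}"] by (cases "\<phi> x = 0") (auto simp: le_max_iff_disj)
  then have B: "(norm (\<phi> x))\<^sup>2 \<le> (max B 0)\<^sup>2" for x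
    by (simp add: power_mono)
  show ?thesis
  proof (rule L2_boundI)
    show "\<phi> \<in> borel_measurable (lebesgue_on \<Omega>)"
      using assms(2) by (intro continuous_imp_measurable_on_sets_lebesgue continuous_on_subset[OF cont]) auto
    show "integrable (lebesgue_on \<Omega>) (\<lambda>x. (max B 0)\<^sup>2)"
      using assms lmeasurable_open finite_measure.integrable_const finite_measure_lebesgue_on by blast
  qed (use B in auto)
qed

text \<open>The curl of a test function is a divergence-free test function, so the weak gradient g
  pairs with it to zero. Equating the predicates transfers the existence of a weak curl as well as
  its values.\<close>

lemma has_weak_curl_add_grad:
  assumes \<Omega>: "open \<Omega>" "bounded \<Omega>"
    and "u \<in> L2 \<Omega>" "v \<in> L2 \<Omega>" "has_weak_grad \<Omega> \<theta> g" "ae_eq \<Omega> u (\<lambda>x. v x + c *\<^sub>R g x)"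
  shows "has_weak_curl \<Omega> u = has_weak_curl \<Omega> v"
proof -
  have g: "g \<in> L2 \<Omega>"
    using assms by (simp add: has_weak_grad_def)
  have "L2_inner \<Omega> u (curl \<phi>) = L2_inner \<Omega> v (curl \<phi>)" if \<phi>: "\<phi> \<in> test_functions \<Omega>" for \<phi>
  proof -
    have c: "curl \<phi> \<in> test_functions \<Omega>" "curl \<phi> \<in> L2 \<Omega>"
      using \<phi> \<Omega> by (auto intro: curl_test_function test_function_L2)
    have "L2_inner_scalar \<Omega> \<theta> (divergence (curl \<phi>)) = 0"
      using divergence_curl[OF test_function_smooth[OF \<phi>]] by (simp add: L2_inner_scalar_def)
    then have "L2_inner \<Omega> g (curl \<phi>) = 0"
      using assms(5) c by (auto simp: has_weak_grad_def)
    moreover have "L2_inner \<Omega> u (curl \<phi>) = L2_inner \<Omega> (\<lambda>x. v x + c *\<^sub>R g x) (curl \<phi>)"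
      using assms c g by (intro L2_inner_cong_ae L2_add_scaleR)
    ultimately show ?thesis
      using assms c g by (simp add: L2_inner_add_scaleR_left)
  qed
  then show ?thesis
    by (auto simp: has_weak_curl_def fun_eq_iff)
qed

lemma H0_curl_L2: "v \<in> H0_curl \<Omega> \<Longrightarrow> v \<in> L2 \<Omega>"
  by (simp add: H0_curl_def)

lemma has_weak_curl_weak_curl: "v \<in> H0_curl \<Omega> \<Longrightarrow> has_weak_curl \<Omega> v (weak_curl \<Omega> v)"
  unfolding weak_curl_def by (rule someI_ex[of "has_weak_curl \<Omega> v"]) (simp add: H0_curl_def)

lemma has_weak_grad_weak_grad: "\<theta> \<in> H10 \<Omega> \<Longrightarrow> has_weak_grad \<Omega> \<theta> (weak_grad \<Omega> \<theta>)"
  unfolding weak_grad_def by (rule someI_ex[of "has_weak_grad \<Omega> \<theta>"]) (simp add: H10_def)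

lemma weak_curl_L2: "v \<in> H0_curl \<Omega> \<Longrightarrow> weak_curl \<Omega> v \<in> L2 \<Omega>"
  using has_weak_curl_weak_curl by (auto simp: has_weak_curl_def)

lemma weak_grad_L2: "\<theta> \<in> H10 \<Omega> \<Longrightarrow> weak_grad \<Omega> \<theta> \<in> L2 \<Omega>"
  using has_weak_grad_weak_grad by (auto simp: has_weak_grad_def)

text \<open>The two weak curls agree as chosen functions, not merely almost everywhere, because \<open>u\<close> and
  \<open>v\<close> have exactly the same weak curls. This makes the uniqueness of weak derivatives dispensable.\<close>

lemma H0_curl_add_grad:
  assumes \<Omega>: "open \<Omega>" "bounded \<Omega>"
    and u: "u \<in> L2 \<Omega>" and v: "v \<in> H0_curl \<Omega>" and \<theta>: "\<theta> \<in> H10 \<Omega>"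
    and ae: "ae_eq \<Omega> u (\<lambda>x. v x + c *\<^sub>R weak_grad \<Omega> \<theta> x)"
  shows "weak_curl \<Omega> u = weak_curl \<Omega> v" "u \<in> H0_curl \<Omega>"
proof -
  let ?g = "weak_grad \<Omega> \<theta>"
  have same: "has_weak_curl \<Omega> u = has_weak_curl \<Omega> v"
    using has_weak_curl_add_grad[OF \<Omega> u H0_curl_L2[OF v] has_weak_grad_weak_grad[OF \<theta>] ae] .
  then show wc: "weak_curl \<Omega> u = weak_curl \<Omega> v"
    by (simp add: weak_curl_def)
  have "\<exists>\<psi>\<in>test_functions \<Omega>. L2_norm \<Omega> (\<lambda>x. u x - \<psi> x) < e \<and>
          L2_norm \<Omega> (\<lambda>x. weak_curl \<Omega> u x - curl \<psi> x) < e" if e: "e > 0" for e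
  proof -
    \<comment> \<open>Chosen so that (1 + |c|) d = e / 2. The factor 2 of the squared estimate then
      leaves e^2 / 2, strictly below e^2.\<close>
    define d where "d = e / (2 * (1 + \<bar>c\<bar>))"
    have d: "d > 0" "d \<le> e"
      using e by (auto simp: d_def field_simps)
    obtain \<phi> where \<phi>: "\<phi> \<in> test_functions \<Omega>" "L2_norm \<Omega> (\<lambda>x. v x - \<phi> x) < d"
      "L2_norm \<Omega> (\<lambda>x. weak_curl \<Omega> v x - curl \<phi> x) < d"
      using v d by (auto simp: H0_curl_def)
    obtain \<eta> where \<eta>: "\<eta> \<in> test_functions \<Omega>" "L2_norm \<Omega> (\<lambda>x. ?g x - grad \<eta> x) < d"
      using \<theta> d by (auto simp: H10_def)
    \<comment> \<open>Approximating v by \<open>\<phi>\<close> and the weak gradient by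
      \<open>grad \<eta>\<close> approximates u by \<open>\<psi>\<close>. Since
      \<open>curl \<psi> = curl \<phi>\<close>, the approximation of the curl is inherited from v
      without further error.\<close>
    define \<psi> where "\<psi> x = \<phi> x + c *\<^sub>R grad \<eta> x" for x
    have g\<eta>: "grad \<eta> \<in> test_functions \<Omega>"
      using \<eta> by (rule_tac grad_test_function)
    have \<psi>: "\<psi> \<in> test_functions \<Omega>"
      unfolding \<psi>_def using \<phi> g\<eta> by (intro add_scaleR_test_function)
    have L: "(\<lambda>x. v x - \<phi> x) \<in> L2 \<Omega>" "(\<lambda>x. ?g x - grad \<eta> x) \<in> L2 \<Omega>" "(\<lambda>x. u x - \<psi> x) \<in> L2 \<Omega>"
      using u H0_curl_L2[OF v] weak_grad_L2[OF \<theta>] test_function_L2[OF \<phi>(1) \<Omega>] test_function_L2[OF g\<eta> \<Omega>]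
        test_function_L2[OF \<psi> \<Omega>] by (auto intro: L2_diff)
    have "L2_norm \<Omega> (\<lambda>x. u x - \<psi> x) = L2_norm \<Omega> (\<lambda>x. (v x - \<phi> x) + c *\<^sub>R (?g x - grad \<eta> x))"
      using ae by (intro L2_norm_cong_ae L L2_add_scaleR)
        (auto simp: ae_eq_def \<psi>_def algebra_simps elim!: eventually_mono)
    then have "(L2_norm \<Omega> (\<lambda>x. u x - \<psi> x))\<^sup>2
        \<le> 2 * (L2_norm \<Omega> (\<lambda>x. v x - \<phi> x))\<^sup>2 + 2 * (c\<^sup>2 * (L2_norm \<Omega> (\<lambda>x. ?g x - grad \<eta> x))\<^sup>2)"
      using L2_norm_add_scaleR[OF L(1,2), of c] by simp
    also have "\<dots> \<le> 2 * d\<^sup>2 + 2 * (c\<^sup>2 * d\<^sup>2)"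
      using \<phi>(2) \<eta>(2) by (intro add_mono mult_left_mono power_mono) auto
    also have "\<dots> \<le> 2 * ((1 + \<bar>c\<bar>)\<^sup>2 * d\<^sup>2)"
      by (simp add: power2_sum algebra_simps)
    also have "\<dots> = 2 * ((1 + \<bar>c\<bar>) * d)\<^sup>2"
      by (simp only: power_mult_distrib)
    also have "(1 + \<bar>c\<bar>) * d = e / 2"
    proof -
      have "k * (e / (2 * k)) = e / 2" if "k \<noteq> 0" for k
        using that by simp
      from this[of "1 + \<bar>c\<bar>"] show ?thesis
        unfolding d_def by linarith
    qed
    also have "2 * (e / 2)\<^sup>2 = e\<^sup>2 / 2"
      by (simp add: power_divide)
    also have "\<dots> < e\<^sup>2"
      using e by simp
    finally have "L2_norm \<Omega> (\<lambda>x. u x - \<psi> x) < e"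
      using e by (simp add: power2_less_imp_less)
    moreover have "curl \<psi> = curl \<phi>"
      using test_function_smooth[OF \<phi>(1)] test_function_smooth[OF g\<eta>] curl_grad[OF test_function_smooth[OF \<eta>(1)]]
      unfolding \<psi>_def[abs_def] by (auto simp: curl_add_scaleR)
    ultimately show ?thesis
      using \<psi> \<phi>(3) d wc by (intro bexI[of _ \<psi>]) auto
  qed
  moreover have "\<exists>g. has_weak_curl \<Omega> u g"
    using v same by (auto simp: H0_curl_def)
  ultimately show "u \<in> H0_curl \<Omega>"
    using u by (auto simp: H0_curl_def)
qed

text \<open>The spaces consist of functions, not classes, so a change of representative has to be
  justified. As with gradients, both functions have the same set of weak curls, hence the same
  chosen one.\<close>

lemma H0_curl_cong_ae:
  assumes \<Omega>: "open \<Omega>" "bounded \<Omega>"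
    and u: "u \<in> L2 \<Omega>" and v: "v \<in> H0_curl \<Omega>" and ae: "ae_eq \<Omega> u v"
  shows "weak_curl \<Omega> u = weak_curl \<Omega> v" "u \<in> H0_curl \<Omega>"
proof -
  have eq: "L2_inner \<Omega> u (curl \<phi>) = L2_inner \<Omega> v (curl \<phi>)" if "\<phi> \<in> test_functions \<Omega>" for \<phi>
    using test_function_L2[OF curl_test_function[OF that] \<Omega>] u ae H0_curl_L2[OF v] by (intro L2_inner_cong_ae)
  then have same: "has_weak_curl \<Omega> u = has_weak_curl \<Omega> v"
    by (auto simp: has_weak_curl_def fun_eq_iff)
  then show wc: "weak_curl \<Omega> u = weak_curl \<Omega> v"
    by (simp add: weak_curl_def)
  have n: "L2_norm \<Omega> (\<lambda>x. u x - \<psi> x) = L2_norm \<Omega> (\<lambda>x. v x - \<psi> x)" if "\<psi> \<in> test_functions \<Omega>" for \<psi>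
    using test_function_L2[OF that \<Omega>] u H0_curl_L2[OF v] ae
    by (intro L2_norm_cong_ae L2_diff) (auto simp: ae_eq_def elim!: eventually_mono)
  have "\<exists>\<phi>\<in>test_functions \<Omega>. L2_norm \<Omega> (\<lambda>x. u x - \<phi> x) < e \<and>
          L2_norm \<Omega> (\<lambda>x. weak_curl \<Omega> u x - curl \<phi> x) < e" if "e > 0" for e
  proof -
    obtain \<phi> where \<phi>: "\<phi> \<in> test_functions \<Omega>" "L2_norm \<Omega> (\<lambda>x. v x - \<phi> x) < e"
      "L2_norm \<Omega> (\<lambda>x. weak_curl \<Omega> v x - curl \<phi> x) < e"
      using v \<open>e > 0\<close> by (auto simp: H0_curl_def)
    then show ?thesis
      using n[OF \<phi>(1)] wc by (intro bexI[of _ \<phi>]) auto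
  qed
  moreover have "\<exists>g. has_weak_curl \<Omega> u g"
    using has_weak_curl_weak_curl[OF v] same by auto
  ultimately show "u \<in> H0_curl \<Omega>"
    using u by (auto simp: H0_curl_def)
qed

text \<open>The weak curl of \<open>v\<close> is orthogonal to all test functions, and it is also a limit of test
  functions because \<open>v\<close> lies in the closure space.\<close>

lemma weak_curl_zero:
  assumes \<Omega>: "open \<Omega>" "bounded \<Omega>"
    and v: "v \<in> H0_curl \<Omega>" and ae: "ae_eq \<Omega> v (\<lambda>x. 0)"
  shows "ae_eq \<Omega> (weak_curl \<Omega> v) (\<lambda>x. 0)"
proof -
  let ?g = "weak_curl \<Omega> v"
  have "(L2_norm \<Omega> ?g)\<^sup>2 \<le> e\<^sup>2" if "e > 0" for e
  proof -
    obtain \<phi> where \<phi>: "\<phi> \<in> test_functions \<Omega>" "L2_norm \<Omega> (\<lambda>x. ?g x - curl \<phi> x) < e"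
      using v \<open>e > 0\<close> unfolding H0_curl_def by blast
    define \<psi> where "\<psi> = curl \<phi>"
    have \<psi>: "\<psi> \<in> test_functions \<Omega>" "\<psi> \<in> L2 \<Omega>"
      using curl_test_function[OF \<phi>(1)] test_function_L2[OF _ \<Omega>] by (auto simp: \<psi>_def)
    have g: "?g \<in> L2 \<Omega>"
      using v by (rule weak_curl_L2)
    have "L2_inner \<Omega> v (curl \<psi>) = L2_inner \<Omega> (\<lambda>x. 0) (curl \<psi>)"
      using test_function_L2[OF curl_test_function[OF \<psi>(1)] \<Omega>] ae H0_curl_L2[OF v] by (intro L2_inner_cong_ae L2_zero)
    then have "L2_inner \<Omega> ?g \<psi> = 0"
      using has_weak_curl_weak_curl[OF v] \<psi>(1) unfolding has_weak_curl_def by (simp add: L2_inner_def)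
    then have z: "(\<integral>x. ?g x \<bullet> \<psi> x \<partial>lebesgue_on \<Omega>) = 0"
      using integral_Re[OF cdot_integrable[OF g \<psi>(2)]] by (simp add: L2_inner_cdot Re_cdot)
    have i: "integrable (lebesgue_on \<Omega>) (\<lambda>x. ?g x \<bullet> \<psi> x)"
      using integrable_Re[OF cdot_integrable[OF g \<psi>(2)]] by (simp add: Re_cdot)
    \<comment> \<open>Pythagoras: \<open>?g\<close> is orthogonal to \<open>\<psi>\<close>, so its
      norm is at most its distance to \<open>\<psi>\<close>, which is below e.\<close>
    have "(L2_norm \<Omega> (\<lambda>x. ?g x - \<psi> x))\<^sup>2
        = (\<integral>x. (norm (?g x))\<^sup>2 + (norm (\<psi> x))\<^sup>2 - 2 * (?g x \<bullet> \<psi> x) \<partial>lebesgue_on \<Omega>)"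
      unfolding L2_norm_power2
      by (intro Bochner_Integration.integral_cong refl)
        (simp add: power2_norm_eq_inner inner_diff_left inner_diff_right inner_commute)
    also have "\<dots> = (L2_norm \<Omega> ?g)\<^sup>2 + (L2_norm \<Omega> \<psi>)\<^sup>2"
      using z i g \<psi> by (simp add: L2_norm_power2 L2_integrable)
    finally have "(L2_norm \<Omega> ?g)\<^sup>2 \<le> (L2_norm \<Omega> (\<lambda>x. ?g x - \<psi> x))\<^sup>2"
      by simp
    also have "\<dots> \<le> e\<^sup>2"
      using \<phi> by (intro power_mono) (auto simp: \<psi>_def)
    finally show ?thesis .
  qed
  then have "L2_norm \<Omega> ?g \<le> 0 + e" if "e > 0" for e
    using that by (simp add: power2_le_iff_abs_le)
  then have "L2_norm \<Omega> ?g \<le> 0"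
    by (rule field_le_epsilon)
  then have "L2_norm \<Omega> ?g = 0"
    by (simp add: order_antisym)
  then show ?thesis
    using L2_norm_eq_0_iff[OF weak_curl_L2[OF v]] by simp
qed

section \<open>Meshes\<close>

text \<open>A polytope of affine dimension at most 2 has empty interior in space, and convex sets
  with empty interior are null. Thus cells, which fill \<open>closure \<Omega>\<close>, exceed
  \<Omega> only by null sets.\<close>

lemma negligible_polyhedral_frontier:
  assumes "polyhedral_boundary \<Omega>"
  shows "negligible (frontier \<Omega>)"
proof -
  obtain F where F: "finite F" "\<And>f. f \<in> F \<Longrightarrow> polytope f \<and> aff_dim f \<le> 2" "frontier \<Omega> = \<Union>F"
    using assms by (auto simp: polyhedral_boundary_def)
  have "negligible f" if "f \<in> F" for f
  proof -
    have "interior f = {}"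
      using aff_dim_nonempty_interior[of f] F(2)[OF that] by auto
    then show ?thesis
      using F(2)[OF that] negligible_convex_interior polytope_imp_convex by blast
  qed
  then show ?thesis
    using F by (auto intro: negligible_Union)
qed

text \<open>Closed cells reach the frontier, where v carries no information. As the excess is null,
  each local norm becomes an indicator-weighted integral over \<Omega>, and such integrals can be
  added over the mesh.\<close>

lemma L2_norm_power2_spike:
  assumes \<Omega>: "open \<Omega>" and v: "v \<in> L2 \<Omega>" and S: "S \<in> sets lebesgue" "negligible (S - \<Omega>)"
  shows "(L2_norm S v)\<^sup>2 = (\<integral>x. indicator S x * (norm (v x))\<^sup>2 \<partial>lebesgue_on \<Omega>)"
    and "integrable (lebesgue_on \<Omega>) (\<lambda>x. indicator S x * (norm (v x))\<^sup>2)"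
proof -
  define f where "f x = (norm (v x))\<^sup>2" for x
  have \<Omega>l: "\<Omega> \<in> sets lebesgue"
    using \<Omega> by auto
  \<comment> \<open>Changes on null sets are made for absolute integrability; this equivalence
    translates to and from Bochner integrability.\<close>
  have iff: "integrable (lebesgue_on T) h \<longleftrightarrow> h absolutely_integrable_on T"
    if "T \<in> sets lebesgue" for T and h :: "real^3 \<Rightarrow> real"
    using that by (simp add: integrable_restrict_space set_integrable_def)
  have f: "f absolutely_integrable_on \<Omega>"
    using L2_integrable[OF v] iff[OF \<Omega>l] by (simp add: f_def[abs_def])
  have SO: "S \<inter> \<Omega> \<in> sets lebesgue"
    using S \<Omega>l by auto
  have A: "f absolutely_integrable_on (S \<inter> \<Omega>)"
    by (rule set_integrable_subset[OF f SO]) auto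
  have B: "f absolutely_integrable_on S"
  proof (rule absolutely_integrable_spike_set_eq[THEN iffD1, OF _ _ A])
    show "negligible {x \<in> S - S \<inter> \<Omega>. f x \<noteq> 0}"
      by (rule negligible_subset[OF S(2)]) auto
    show "negligible {x \<in> S \<inter> \<Omega> - S. f x \<noteq> 0}"
      by (rule negligible_subset[OF negligible_empty]) auto
  qed
  have ind: "indicator \<Omega> x *\<^sub>R (indicator S x * f x) = indicator (S \<inter> \<Omega>) x *\<^sub>R f x" for x
    by (auto simp: indicator_def)
  have "integrable (lebesgue_on S) f"
    using B iff[OF S(1)] by simp
  then have "(L2_norm S v)\<^sup>2 = integral S f"
    using lebesgue_integral_eq_integral[of S f] S(1) by (simp add: L2_norm_power2 flip: f_def)
  also have "\<dots> = integral (S \<inter> \<Omega>) f"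
  proof (rule integral_spike_set)
    show "negligible {x \<in> S - S \<inter> \<Omega>. f x \<noteq> 0}"
      by (rule negligible_subset[OF S(2)]) auto
    show "negligible {x \<in> S \<inter> \<Omega> - S. f x \<noteq> 0}"
      by (rule negligible_subset[OF negligible_empty]) auto
  qed
  also have "\<dots> = (\<integral>x. f x \<partial>lebesgue_on (S \<inter> \<Omega>))"
    using lebesgue_integral_eq_integral[of "S \<inter> \<Omega>" f] A iff[OF SO, of f] SO by simp
  also have "\<dots> = (\<integral>x. indicator S x * f x \<partial>lebesgue_on \<Omega>)"
    using SO \<Omega>l by (simp only: integral_restrict_space ind sets.Int space_borel Int_UNIV_right space_completion
        space_lborel sets.top)
  finally show "(L2_norm S v)\<^sup>2 = (\<integral>x. indicator S x * (norm (v x))\<^sup>2 \<partial>lebesgue_on \<Omega>)"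
    by (simp add: f_def)
  have "(\<lambda>x. indicator S x * f x) absolutely_integrable_on \<Omega>"
    using A unfolding set_integrable_def ind .
  then show "integrable (lebesgue_on \<Omega>) (\<lambda>x. indicator S x * (norm (v x))\<^sup>2)"
    using iff[OF \<Omega>l] by (simp add: f_def)
qed

text \<open>After exchanging sum and integral, the sum of indicators at x counts the sets containing
  x.\<close>

lemma sum_L2_norm_overlap_le:
  fixes M :: real
  assumes \<Omega>: "open \<Omega>" and v: "v \<in> L2 \<Omega>" and fin: "finite \<T>"
    and N: "\<And>T. T \<in> \<T> \<Longrightarrow> N T \<in> sets lebesgue" "\<And>T. T \<in> \<T> \<Longrightarrow> negligible (N T - \<Omega>)"
    and M: "\<And>x. card {T\<in>\<T>. x \<in> N T} \<le> M"
  shows "(\<Sum>T\<in>\<T>. (L2_norm (N T) v)\<^sup>2) \<le> M * (L2_norm \<Omega> v)\<^sup>2"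
proof -
  note sp = L2_norm_power2_spike[OF \<Omega> v N]
  have "(\<Sum>T\<in>\<T>. (L2_norm (N T) v)\<^sup>2) = (\<Sum>T\<in>\<T>. \<integral>x. indicator (N T) x * (norm (v x))\<^sup>2 \<partial>lebesgue_on \<Omega>)"
    using sp(1) by (intro sum.cong) auto
  also have "\<dots> = (\<integral>x. (\<Sum>T\<in>\<T>. indicator (N T) x * (norm (v x))\<^sup>2) \<partial>lebesgue_on \<Omega>)"
    using sp(2) by (subst Bochner_Integration.integral_sum) auto
  also have "\<dots> \<le> (\<integral>x. M * (norm (v x))\<^sup>2 \<partial>lebesgue_on \<Omega>)"
  proof (rule integral_mono)
    show "integrable (lebesgue_on \<Omega>) (\<lambda>x. \<Sum>T\<in>\<T>. indicator (N T) x * (norm (v x))\<^sup>2)"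
      using sp(2) by auto
    show "integrable (lebesgue_on \<Omega>) (\<lambda>x. M * (norm (v x))\<^sup>2)"
      using L2_integrable[OF v] by simp
    show "(\<Sum>T\<in>\<T>. indicator (N T) x * (norm (v x))\<^sup>2) \<le> M * (norm (v x))\<^sup>2" for x
    proof -
      have "(\<Sum>T\<in>\<T>. indicator (N T) x * (norm (v x))\<^sup>2) = real (card {T\<in>\<T>. x \<in> N T}) * (norm (v x))\<^sup>2"
        using fin by (simp add: indicator_def sum.If_cases Int_def flip: sum_distrib_right)
      then show ?thesis
        using M[of x] by (simp add: mult_right_mono)
    qed
  qed
  also have "\<dots> = M * (L2_norm \<Omega> v)\<^sup>2"
    by (simp add: L2_norm_power2)
  finally show ?thesis .
qed

text \<open>Every point of \<Omega> is counted at least once; repeated counting on shared faces only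
  enlarges the right side.\<close>

lemma L2_norm_le_sum_cover:
  assumes \<Omega>: "open \<Omega>" and v: "v \<in> L2 \<Omega>" and fin: "finite \<T>"
    and N: "\<And>T. T \<in> \<T> \<Longrightarrow> T \<in> sets lebesgue" "\<And>T. T \<in> \<T> \<Longrightarrow> negligible (T - \<Omega>)"
    and cover: "\<Omega> \<subseteq> \<Union>\<T>"
  shows "(L2_norm \<Omega> v)\<^sup>2 \<le> (\<Sum>T\<in>\<T>. (L2_norm T v)\<^sup>2)"
proof -
  note sp = L2_norm_power2_spike[OF \<Omega> v N]
  have "(L2_norm \<Omega> v)\<^sup>2 \<le> (\<integral>x. (\<Sum>T\<in>\<T>. indicator T x * (norm (v x))\<^sup>2) \<partial>lebesgue_on \<Omega>)"
    unfolding L2_norm_power2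
  proof (rule integral_mono)
    show "integrable (lebesgue_on \<Omega>) (\<lambda>x. \<Sum>T\<in>\<T>. indicator T x * (norm (v x))\<^sup>2)"
      using sp(2) by auto
    show "integrable (lebesgue_on \<Omega>) (\<lambda>x. (norm (v x))\<^sup>2)"
      using L2_integrable[OF v] .
    show "(norm (v x))\<^sup>2 \<le> (\<Sum>T\<in>\<T>. indicator T x * (norm (v x))\<^sup>2)"
      if "x \<in> space (lebesgue_on \<Omega>)" for x
    proof -
      have "x \<in> \<Omega>"
        using that by (simp add: space_restrict_space)
      then obtain T where T: "T \<in> \<T>" "x \<in> T"
        using cover by auto
      have "(norm (v x))\<^sup>2 = indicator T x * (norm (v x))\<^sup>2"
        using T by simp
      also have "\<dots> \<le> (\<Sum>T\<in>\<T>. indicator T x * (norm (v x))\<^sup>2)"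
        by (rule member_le_sum[OF T(1) _ fin]) (simp add: indicator_def)
      finally show ?thesis .
    qed
  qed
  also have "\<dots> = (\<Sum>T\<in>\<T>. \<integral>x. indicator T x * (norm (v x))\<^sup>2 \<partial>lebesgue_on \<Omega>)"
    using sp(2) by (subst Bochner_Integration.integral_sum) auto
  also have "\<dots> = (\<Sum>T\<in>\<T>. (L2_norm T v)\<^sup>2)"
    using sp(1) by (intro sum.cong) auto
  finally show ?thesis .
qed

text \<open>Volume ratio of balls of radii (k + 2) H and H / (\<sigma> \<tau>). The mesh size
  cancels, which makes the later constants independent of H.\<close>

definition overlap :: "real \<Rightarrow> real \<Rightarrow> nat \<Rightarrow> real" where
  "overlap \<sigma> \<tau> k = ((real k + 2) * (\<sigma> * \<tau>)) ^ 3"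

section \<open>Geometry of cells and patches\<close>

locale mesh =
  fixes \<Omega> :: "(real^3) set" and \<sigma> \<tau> :: real and \<T> :: "(real^3) set set"
  assumes domain: "admissible_domain \<Omega>" and mesh: "admissible_mesh \<Omega> \<sigma> \<tau> \<T>"
begin

abbreviation "H \<equiv> mesh_size \<T>"

lemma open_domain: "open \<Omega>" and bounded_domain: "bounded \<Omega>" and nonempty_domain: "\<Omega> \<noteq> {}"
  and negligible_frontier: "negligible (frontier \<Omega>)"
  using domain by (auto simp: admissible_domain_def negligible_polyhedral_frontier)

lemma finite_mesh: "finite \<T>"
  using mesh by (auto simp: admissible_mesh_def triangulation_def)

lemma Union_mesh: "\<Union>\<T> = closure \<Omega>"
  using mesh by (auto simp: admissible_mesh_def)

lemma compact_cell: "T \<in> \<T> \<Longrightarrow> compact T"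
  using mesh compact_simplex by (auto simp: admissible_mesh_def)

lemma diameter_cell_le: "T \<in> \<T> \<Longrightarrow> diameter T \<le> H"
  unfolding mesh_size_def using finite_mesh by (intro Max_ge) auto

lemma dist_cell_le: "T \<in> \<T> \<Longrightarrow> x \<in> T \<Longrightarrow> y \<in> T \<Longrightarrow> dist x y \<le> H"
  using diameter_bounded_bound[OF compact_imp_bounded[OF compact_cell]] diameter_cell_le by fastforce

lemma mesh_nonempty: "\<T> \<noteq> {}"
  using Union_mesh nonempty_domain closure_subset by fastforce

lemma diameter_pos:
  assumes "T \<in> \<T>"
  shows "0 < diameter T"
proof -
  obtain x r where r: "r > 0" "ball x r \<subseteq> T"
    using mesh assms by (auto simp: admissible_mesh_def)
  have "0 < diameter (ball x r)"
    using r by (simp add: diameter_ball)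
  also have "\<dots> \<le> diameter T"
    by (rule diameter_subset[OF r(2) compact_imp_bounded[OF compact_cell[OF assms]]])
  finally show ?thesis .
qed

lemma mesh_size_pos: "0 < H"
  using mesh_nonempty diameter_pos diameter_cell_le by (meson all_not_in_conv less_le_trans)

text \<open>The signs are forced by the presence of a cell of positive diameter.\<close>

lemma constants_pos: "0 < \<sigma>" "0 < \<tau>"
proof -
  obtain T where T: "T \<in> \<T>"
    using mesh_nonempty by auto
  obtain x r where r: "r > 0" "diameter T \<le> \<sigma> * r"
    using mesh T by (auto simp: admissible_mesh_def)
  then show "0 < \<sigma>"
    using diameter_pos[OF T] by (metis less_le_trans mult.commute zero_less_mult_pos)
  have "H \<le> \<tau> * diameter T"
    using mesh T by (auto simp: admissible_mesh_def)
  then show "0 < \<tau>"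
    using diameter_pos[OF T] mesh_size_pos by (metis less_le_trans mult.commute zero_less_mult_pos)
qed

text \<open>A radius common to all cells: quasi-uniformity gives \<open>diameter T\<close> at least
  H / \<tau>, and shape regularity an inscribed ball of radius at least \<open>diameter T\<close> /
  \<sigma>.\<close>

definition inradius :: real where
  "inradius = H / (\<sigma> * \<tau>)"

lemma inradius_pos: "0 < inradius"
  using constants_pos mesh_size_pos by (simp add: inradius_def)

lemma inball_exists:
  assumes "T \<in> \<T>"
  shows "\<exists>c. ball c inradius \<subseteq> T"
proof -
  obtain c r where r: "r > 0" "ball c r \<subseteq> T" "diameter T \<le> \<sigma> * r"
    using mesh assms by (auto simp: admissible_mesh_def)
  have "H \<le> \<tau> * diameter T"
    using mesh assms by (auto simp: admissible_mesh_def)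
  also have "\<dots> \<le> \<tau> * (\<sigma> * r)"
    using r constants_pos by (simp add: mult_left_mono)
  finally have "inradius \<le> r"
    using constants_pos by (simp add: inradius_def field_simps)
  then show ?thesis
    using r by (meson order_trans subset_ball)
qed

definition centre :: "(real^3) set \<Rightarrow> real^3" where
  "centre T = (SOME c. ball c inradius \<subseteq> T)"

lemma inball: "T \<in> \<T> \<Longrightarrow> ball (centre T) inradius \<subseteq> T"
  unfolding centre_def by (rule someI_ex) (rule inball_exists)

lemma centre_in: "T \<in> \<T> \<Longrightarrow> centre T \<in> T"
  using inball inradius_pos by (meson centre_in_ball subsetD)

text \<open>The intersection of two distinct cells is a proper face of at least one of them, and a
  proper face misses the interior. The open balls lie in the interiors.\<close>

lemma inballs_disjoint:
  assumes "T \<in> \<T>" "T' \<in> \<T>" "T \<noteq> T'"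
  shows "ball (centre T) inradius \<inter> ball (centre T') inradius = {}"
proof -
  have faces: "T \<inter> T' face_of T" "T \<inter> T' face_of T'"
    using mesh assms unfolding admissible_mesh_def triangulation_def by (metis inf_commute)+
  have "ball (centre T) inradius \<subseteq> interior T" "ball (centre T') inradius \<subseteq> interior T'"
    using inball assms by (simp_all add: interior_maximal)
  then have "ball (centre T) inradius \<inter> ball (centre T') inradius \<subseteq> interior T \<inter> interior T' \<inter> (T \<inter> T')"
    using interior_subset by blast
  also have "\<dots> = {}"
    using face_of_disjoint_interior[OF faces(1)] face_of_disjoint_interior[OF faces(2)] assms(3) by blast
  finally show ?thesis by simp
qed

text \<open>Closed balls absorb the closure taken in \<open>patch\<close>; each touching cell then
  adds one mesh size.\<close>

lemma patch_subset_cball: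
  assumes "G \<subseteq> cball c r"
  shows "patch \<T> G \<subseteq> cball c (r + H)"
proof
  fix x assume "x \<in> patch \<T> G"
  then obtain T where T: "T \<in> \<T>" "T \<inter> closure G \<noteq> {}" "x \<in> T"
    unfolding patch_def using interior_subset by blast
  then obtain y where y: "y \<in> T" "y \<in> closure G"
    by auto
  have "y \<in> cball c r"
    using y(2) closure_minimal[OF assms] by auto
  then have "dist c y \<le> r"
    by simp
  moreover have "dist y x \<le> H"
    using dist_cell_le[OF T(1) y(1) T(3)] .
  ultimately show "x \<in> cball c (r + H)"
    using dist_triangle[of c x y] by simp
qed

lemma iterated_patch_subset_cball:
  assumes "T \<in> \<T>"
  shows "(patch \<T> ^^ k) T \<subseteq> cball (centre T) (real (Suc k) * H)"
proof (induction k)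
  case 0
  then show ?case
    using dist_cell_le[OF assms centre_in[OF assms]] by auto
next
  case (Suc k)
  then show ?case
    using patch_subset_cball[OF Suc.IH] by (simp add: algebra_simps)
qed

text \<open>The inscribed balls of the cells whose \<open>k\<close>-th patch contains \<open>x\<close> are disjoint and lie in a ball
  of radius \<open>(k + 2) H\<close>, so comparing volumes bounds their number.\<close>

lemma card_patches_le: "card {T\<in>\<T>. x \<in> (patch \<T> ^^ k) T} \<le> overlap \<sigma> \<tau> k"
proof -
  define A where "A = {T\<in>\<T>. x \<in> (patch \<T> ^^ k) T}"
  have fin: "finite A"
    using finite_mesh by (simp add: A_def)
  have "(\<Union>T\<in>A. ball (centre T) inradius) \<subseteq> cball x ((real k + 2) * H)"
  proof
    fix y assume "y \<in> (\<Union>T\<in>A. ball (centre T) inradius)"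
    then obtain T where T: "T \<in> \<T>" "x \<in> (patch \<T> ^^ k) T" "y \<in> T"
      using inball unfolding A_def by blast
    \<comment> \<open>The extra H for the inscribed ball, added to the (k + 1) H for the patch,
      gives the radius (k + 2) H.\<close>
    have "dist (centre T) y \<le> H" "dist (centre T) x \<le> real (Suc k) * H"
      using dist_cell_le[OF T(1) centre_in[OF T(1)] T(3)] iterated_patch_subset_cball[OF T(1), of k] T(2)
      by auto
    then show "y \<in> cball x ((real k + 2) * H)"
      using dist_triangle[of x y "centre T"] by (simp add: dist_commute algebra_simps)
  qed
  then have "measure lebesgue (\<Union>T\<in>A. ball (centre T) inradius) \<le> measure lebesgue (cball x ((real k + 2) * H))"
    using fin by (intro measure_mono_fmeasurable) auto
  also have "\<dots> = unit_ball_vol 3 * ((real k + 2) * H) ^ 3"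
    using mesh_size_pos content_cball[of "(real k + 2) * H" x] by simp
  also have "measure lebesgue (\<Union>T\<in>A. ball (centre T) inradius) = (\<Sum>T\<in>A. measure lebesgue (ball (centre T) inradius))"
  proof (rule measure_negligible_finite_Union_image[OF fin])
    show "pairwise (\<lambda>T T'. negligible (ball (centre T) inradius \<inter> ball (centre T') inradius)) A"
      using inballs_disjoint by (auto simp: pairwise_def A_def)
  qed simp
  also have "\<dots> = card A * (unit_ball_vol 3 * inradius ^ 3)"
    using inradius_pos by (simp add: content_ball)
  finally have "card A * inradius ^ 3 \<le> ((real k + 2) * H) ^ 3"
    by (simp add: mult.left_commute)
  also have "\<dots> = overlap \<sigma> \<tau> k * inradius ^ 3"
    using constants_pos by (simp add: overlap_def inradius_def power_divide power_mult_distrib)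
  finally show ?thesis
    using inradius_pos by (simp add: A_def)
qed

lemma negligible_outside: "S \<subseteq> closure \<Omega> \<Longrightarrow> negligible (S - \<Omega>)"
  by (rule negligible_subset[OF negligible_frontier])
    (use open_domain in \<open>auto simp: frontier_def interior_open\<close>)

lemma patch_subset_closure: "patch \<T> G \<subseteq> closure \<Omega>"
  unfolding patch_def using interior_subset Union_mesh by fastforce

lemma sum_patches_le:
  assumes "v \<in> L2 \<Omega>" "k > 0"
  shows "(\<Sum>T\<in>\<T>. (L2_norm ((patch \<T> ^^ k) T) v)\<^sup>2) \<le> overlap \<sigma> \<tau> k * (L2_norm \<Omega> v)\<^sup>2"
proof -
  \<comment> \<open>For positive k the set is itself a patch, hence open and contained in
    \<open>closure \<Omega>\<close>.\<close>
  obtain j where "k = Suc j"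
    using assms by (cases k) auto
  then have p: "(patch \<T> ^^ k) T = patch \<T> ((patch \<T> ^^ j) T)" for T
    by simp
  show ?thesis
  proof (rule sum_L2_norm_overlap_le[OF open_domain assms(1) finite_mesh])
    show "(patch \<T> ^^ k) T \<in> sets lebesgue" for T
      unfolding p by (simp add: patch_def)
    show "negligible ((patch \<T> ^^ k) T - \<Omega>)" for T
      unfolding p by (rule negligible_outside[OF patch_subset_closure])
  qed (rule card_patches_le)
qed

text \<open>The constants of the theorem are fixed before any mesh is given, when the sign of
  \<open>overlap\<close> is unknown. The absolute value keeps them nonnegative
  unconditionally.\<close>

lemma sum_patches_abs_le:
  assumes "v \<in> L2 \<Omega>" "k > 0"
  shows "(\<Sum>T\<in>\<T>. (L2_norm ((patch \<T> ^^ k) T) v)\<^sup>2) \<le> \<bar>overlap \<sigma> \<tau> k\<bar> * (L2_norm \<Omega> v)\<^sup>2"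
  using sum_patches_le[OF assms] mult_right_mono[OF abs_ge_self, of "(L2_norm \<Omega> v)\<^sup>2" "overlap \<sigma> \<tau> k"]
  by simp

lemma L2_norm_le_sum_cells:
  assumes "v \<in> L2 \<Omega>"
  shows "(L2_norm \<Omega> v)\<^sup>2 \<le> (\<Sum>T\<in>\<T>. (L2_norm T v)\<^sup>2)"
proof (rule L2_norm_le_sum_cover[OF open_domain assms finite_mesh])
  show "T \<in> sets lebesgue" if "T \<in> \<T>" for T
    using compact_cell[OF that] by (simp add: compact_imp_closed)
  show "negligible (T - \<Omega>)" if "T \<in> \<T>" for T
    using negligible_outside Union_mesh that by blast
  show "\<Omega> \<subseteq> \<Union>\<T>"
    using Union_mesh closure_subset by simp
qed

end

section \<open>Coefficients\<close>

text \<open>A real matrix acts on real and imaginary parts separately, and cross terms are absent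
  from the real inner product. Bounds for real vectors therefore extend to complex ones.\<close>

lemma real_matrix_mult_parts:
  fixes A :: "real^3^3" and v :: "complex^3"
  defines "x \<equiv> \<chi> i. Re (v $ i)" and "y \<equiv> \<chi> i. Im (v $ i)"
  shows "(norm v)\<^sup>2 = (norm x)\<^sup>2 + (norm y)\<^sup>2"
    and "(norm (real_matrix_mult A v))\<^sup>2 = (norm (A *v x))\<^sup>2 + (norm (A *v y))\<^sup>2"
    and "real_matrix_mult A v \<bullet> v = (A *v x) \<bullet> x + (A *v y) \<bullet> y"
proof -
  have parts: "Re (real_matrix_mult A v $ i) = (A *v x) $ i" "Im (real_matrix_mult A v $ i) = (A *v y) $ i" for i
    by (simp_all add: real_matrix_mult_def matrix_vector_mult_def x_def y_def)
  show "(norm v)\<^sup>2 = (norm x)\<^sup>2 + (norm y)\<^sup>2"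
    by (simp add: power2_norm_eq_inner inner_vec_def inner_complex_def sum.distrib x_def y_def)
  show "(norm (real_matrix_mult A v))\<^sup>2 = (norm (A *v x))\<^sup>2 + (norm (A *v y))\<^sup>2"
    by (simp add: power2_norm_eq_inner inner_vec_def inner_complex_def sum.distrib parts)
  show "real_matrix_mult A v \<bullet> v = (A *v x) \<bullet> x + (A *v y) \<bullet> y"
    unfolding inner_vec_def inner_complex_def sum.distrib parts by (simp add: x_def y_def)
qed

lemma real_matrix_mult_bounds:
  assumes "\<forall>\<xi>. norm (A *v \<xi>) \<le> M * norm \<xi> \<and> a * (norm \<xi>)\<^sup>2 \<le> (A *v \<xi>) \<bullet> \<xi>"
  shows "(norm (real_matrix_mult A v))\<^sup>2 \<le> M\<^sup>2 * (norm v)\<^sup>2" "a * (norm v)\<^sup>2 \<le> real_matrix_mult A v \<bullet> v"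
proof -
  have "(norm (A *v \<xi>))\<^sup>2 \<le> M\<^sup>2 * (norm \<xi>)\<^sup>2" for \<xi>
    using assms power_mono[of "norm (A *v \<xi>)" "M * norm \<xi>" 2] by (simp add: power_mult_distrib)
  then show "(norm (real_matrix_mult A v))\<^sup>2 \<le> M\<^sup>2 * (norm v)\<^sup>2"
    unfolding real_matrix_mult_parts(1)[of v] real_matrix_mult_parts(2)[of A v] by (simp add: distrib_left add_mono)
  show "a * (norm v)\<^sup>2 \<le> real_matrix_mult A v \<bullet> v"
    unfolding real_matrix_mult_parts(1)[of v] real_matrix_mult_parts(3)[of A v]
    using assms by (simp add: distrib_left add_mono)
qed

lemma elliptic_L2:
  assumes A: "elliptic_coefficient \<Omega> a M A" and v: "v \<in> L2 \<Omega>"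
  shows "(\<lambda>x. real_matrix_mult (A x) (v x)) \<in> L2 \<Omega>"
proof (rule L2_boundI)
  have "continuous_on UNIV (\<lambda>p :: (real^3^3) \<times> (complex^3). real_matrix_mult (fst p) (snd p))"
    unfolding real_matrix_mult_def by (intro continuous_intros)
  then show "(\<lambda>x. real_matrix_mult (A x) (v x)) \<in> borel_measurable (lebesgue_on \<Omega>)"
    by (rule borel_measurable_continuous_Pair[rotated 2])
      (use A v in \<open>auto simp: elliptic_coefficient_def L2_measurable\<close>)
  show "integrable (lebesgue_on \<Omega>) (\<lambda>x. M\<^sup>2 * (norm (v x))\<^sup>2)"
    using L2_integrable[OF v] by simp
  show "AE x in lebesgue_on \<Omega>. (norm (real_matrix_mult (A x) (v x)))\<^sup>2 \<le> M\<^sup>2 * (norm (v x))\<^sup>2"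
    using A unfolding elliptic_coefficient_def by (auto elim!: eventually_mono intro: real_matrix_mult_bounds)
qed

lemma Re_L2_inner:
  assumes "u \<in> L2 \<Omega>" "v \<in> L2 \<Omega>"
  shows "Re (L2_inner \<Omega> u v) = (\<integral>x. u x \<bullet> v x \<partial>lebesgue_on \<Omega>)"
    and "integrable (lebesgue_on \<Omega>) (\<lambda>x. u x \<bullet> v x)"
  using integral_Re[OF cdot_integrable[OF assms]] integrable_Re[OF cdot_integrable[OF assms]]
  by (simp_all add: L2_inner_cdot Re_cdot)

lemma elliptic_coercive:
  assumes A: "elliptic_coefficient \<Omega> a M A" and v: "v \<in> L2 \<Omega>"
  shows "a * (L2_norm \<Omega> v)\<^sup>2 \<le> Re (L2_inner \<Omega> (\<lambda>x. real_matrix_mult (A x) (v x)) v)"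
proof -
  have "(\<integral>x. a * (norm (v x))\<^sup>2 \<partial>lebesgue_on \<Omega>) \<le> (\<integral>x. real_matrix_mult (A x) (v x) \<bullet> v x \<partial>lebesgue_on \<Omega>)"
  proof (rule integral_mono_AE)
    show "AE x in lebesgue_on \<Omega>. a * (norm (v x))\<^sup>2 \<le> real_matrix_mult (A x) (v x) \<bullet> v x"
      using A unfolding elliptic_coefficient_def by (auto elim!: eventually_mono intro: real_matrix_mult_bounds)
  qed (use Re_L2_inner(2)[OF elliptic_L2[OF A v] v] L2_integrable[OF v] in simp_all)
  then show ?thesis
    by (simp add: L2_norm_power2 Re_L2_inner(1)[OF elliptic_L2[OF A v] v])
qed

text \<open>Young's inequality with weight d, pointwise and then integrated. It serves with u = z -
  \<pi>E z: a small d lets ellipticity of \<epsilon> absorb the v-term, and the large factor 1 / d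
  is compensated by a small \<omega> H.\<close>

lemma elliptic_Young:
  assumes A: "elliptic_coefficient \<Omega> a M A" and v: "v \<in> L2 \<Omega>" and u: "u \<in> L2 \<Omega>" and d: "d > 0"
  shows "2 * Re (L2_inner \<Omega> (\<lambda>x. real_matrix_mult (A x) (v x)) u)
    \<le> \<bar>M\<bar> * (d * (L2_norm \<Omega> v)\<^sup>2 + (L2_norm \<Omega> u)\<^sup>2 / d)"
proof -
  have young: "2 * (q \<bullet> b) \<le> \<bar>M\<bar> * (d * (norm c)\<^sup>2 + (norm b)\<^sup>2 / d)"
    if "(norm q)\<^sup>2 \<le> M\<^sup>2 * (norm c)\<^sup>2" for b c q :: "complex^3"
  proof -
    have "norm q \<le> \<bar>M\<bar> * norm c"
      using that by (metis abs_norm_cancel abs_mult power_mult_distrib abs_le_square_iff)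
    then have "q \<bullet> b \<le> \<bar>M\<bar> * norm c * norm b"
      using norm_cauchy_schwarz[of q b] mult_right_mono[of "norm q" "\<bar>M\<bar> * norm c" "norm b"] by simp
    moreover have "2 * (norm c * norm b) \<le> d * (norm c)\<^sup>2 + (norm b)\<^sup>2 / d"
    proof -
      have "0 \<le> (d * norm c - norm b)\<^sup>2 / d"
        using d by simp
      also have "\<dots> = d * (norm c)\<^sup>2 + (norm b)\<^sup>2 / d - 2 * (norm c * norm b)"
        using d by (simp add: power2_eq_square field_simps)
      finally show ?thesis by simp
    qed
    ultimately show ?thesis
      using mult_left_mono[of "2 * (norm c * norm b)" "d * (norm c)\<^sup>2 + (norm b)\<^sup>2 / d" "\<bar>M\<bar>"]
      by (simp add: algebra_simps)
  qed
  have "(\<integral>x. 2 * (real_matrix_mult (A x) (v x) \<bullet> u x) \<partial>lebesgue_on \<Omega>)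
      \<le> (\<integral>x. \<bar>M\<bar> * (d * (norm (v x))\<^sup>2 + (norm (u x))\<^sup>2 / d) \<partial>lebesgue_on \<Omega>)"
  proof (rule integral_mono_AE)
    show "AE x in lebesgue_on \<Omega>. 2 * (real_matrix_mult (A x) (v x) \<bullet> u x)
        \<le> \<bar>M\<bar> * (d * (norm (v x))\<^sup>2 + (norm (u x))\<^sup>2 / d)"
      using A unfolding elliptic_coefficient_def
      by (auto elim!: eventually_mono intro!: young real_matrix_mult_bounds(1))
  qed (use Re_L2_inner(2)[OF elliptic_L2[OF A v] u] L2_integrable[OF v] L2_integrable[OF u] in simp_all)
  then show ?thesis
    using L2_integrable[OF v] L2_integrable[OF u]
    by (simp add: L2_norm_power2 Re_L2_inner(1)[OF elliptic_L2[OF A v] u])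
qed

lemma curl_norm_power2:
  "(curl_norm \<Omega> \<omega> v)\<^sup>2 = (L2_norm \<Omega> (weak_curl \<Omega> v))\<^sup>2 + \<omega>\<^sup>2 * (L2_norm \<Omega> v)\<^sup>2"
  by (simp add: curl_norm_def curl_inner_def L2_inner_self flip: of_real_mult of_real_add of_real_power)

lemma curl_norm_nonneg: "0 \<le> curl_norm \<Omega> \<omega> v"
  by (simp add: curl_norm_def curl_inner_def L2_inner_self flip: of_real_mult of_real_add of_real_power)

lemma triple_norm_power2:
  "(triple_norm \<Omega> \<omega> z \<theta>)\<^sup>2 = (L2_norm \<Omega> (weak_curl \<Omega> z))\<^sup>2 + \<omega>\<^sup>2 * (L2_norm \<Omega> (weak_grad \<Omega> \<theta>))\<^sup>2"
  by (simp add: triple_norm_def)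

section \<open>The kernel of the interpolation\<close>

lemma H10_vec_L2:
  assumes "z \<in> H10_vec \<Omega>"
  shows "z \<in> L2 \<Omega>"
proof -
  have "(\<lambda>x. axis i (z x $ i) :: complex^3) \<in> L2 \<Omega>" for i
  proof (rule L2_boundI)
    have zi: "(\<lambda>x. z x $ i) \<in> L2 \<Omega>"
      using assms by (simp add: H10_vec_def H10_def)
    show "(\<lambda>x. axis i (z x $ i) :: complex^3) \<in> borel_measurable (lebesgue_on \<Omega>)"
      by (rule borel_measurable_continuous_on[OF bounded_linear.continuous_on[OF bounded_linear_axis continuous_on_id]
            L2_measurable[OF zi]])
    show "integrable (lebesgue_on \<Omega>) (\<lambda>x. (norm (z x $ i))\<^sup>2)"
      by (rule L2_integrable[OF zi])
  qed (simp add: norm_axis_complex)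
  from L2_add_scaleR[OF this[of 1] L2_add_scaleR[OF this[of 2] this[of 3], of 1], of 1]
  have "(\<lambda>x. axis 1 (z x $ 1) + (axis 2 (z x $ 2) + axis 3 (z x $ 3)) :: complex^3) \<in> L2 \<Omega>"
    by simp
  also have "(\<lambda>x. axis 1 (z x $ 1) + (axis 2 (z x $ 2) + axis 3 (z x $ 3)) :: complex^3) = z"
    by (auto simp: vec_eq_iff axis_def forall_3)
  finally show ?thesis .
qed

text \<open>Factor in the global bound of the squared norm of z by H^2 times that of curl w:
  \<open>KR\<close> comes squared from the local bound, and 3 is the number of patch layers in
  it.\<close>

definition regular_constant :: "real \<Rightarrow> real \<Rightarrow> real \<Rightarrow> real" where
  "regular_constant \<sigma> \<tau> KR = KR\<^sup>2 * \<bar>overlap \<sigma> \<tau> 3\<bar>"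

text \<open>The analogous factor for z - \<pi>E z. It collects 2 |z|^2 + 2 |\<pi>E z|^2, where
  \<open>interp_le\<close> bounds the second square; the summand 1 stands for the curl term
  there.\<close>

definition kernel_constant :: "real \<Rightarrow> real \<Rightarrow> real \<Rightarrow> real \<Rightarrow> real" where
  "kernel_constant \<sigma> \<tau> KF KR = 2 * regular_constant \<sigma> \<tau> KR
     + 4 * KF\<^sup>2 * \<bar>overlap \<sigma> \<tau> 1\<bar> * (regular_constant \<sigma> \<tau> KR + 1)"

lemma regular_constant_nonneg: "0 \<le> regular_constant \<sigma> \<tau> KR"
  by (simp add: regular_constant_def)

lemma kernel_constant_nonneg: "0 \<le> kernel_constant \<sigma> \<tau> KF KR"
  by (simp add: kernel_constant_def regular_constant_nonneg)

section \<open>Global interpolation bounds and construction of the test field\<close>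

locale interpolation = mesh +
  fixes KF KR :: real and \<pi>E
  assumes falk_winther: "falk_winther_interpolation \<Omega> \<T> KF \<pi>E"
begin

lemma linear_projection_interp: "linear_projection \<Omega> (*s) (H0_curl \<Omega>) (nedelec \<Omega> \<T>) \<pi>E"
  using falk_winther by (simp add: falk_winther_interpolation_def)

lemma interp_nedelec: "v \<in> H0_curl \<Omega> \<Longrightarrow> \<pi>E v \<in> nedelec \<Omega> \<T>"
  and interp_cong: "v \<in> H0_curl \<Omega> \<Longrightarrow> w \<in> H0_curl \<Omega> \<Longrightarrow> ae_eq \<Omega> v w \<Longrightarrow> ae_eq \<Omega> (\<pi>E v) (\<pi>E w)"
  and interp_add: "v \<in> H0_curl \<Omega> \<Longrightarrow> w \<in> H0_curl \<Omega> \<Longrightarrow> ae_eq \<Omega> (\<pi>E (\<lambda>x. v x + w x)) (\<lambda>x. \<pi>E v x + \<pi>E w x)"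
  and interp_projection: "v \<in> nedelec \<Omega> \<T> \<Longrightarrow> ae_eq \<Omega> (\<pi>E v) v"
  using linear_projection_interp by (simp_all add: linear_projection_def)

lemma interp_H0_curl: "v \<in> H0_curl \<Omega> \<Longrightarrow> \<pi>E v \<in> H0_curl \<Omega>"
  using interp_nedelec by (simp add: nedelec_def)

text \<open>Part of the commuting diagram: the new potential is the interpolant of \<theta> in the
  Lagrange space, which lies in \<open>H10\<close>.\<close>

lemma interp_grad:
  assumes "\<theta> \<in> H10 \<Omega>"
  obtains \<eta> where "\<eta> \<in> H10 \<Omega>" "ae_eq \<Omega> (\<pi>E (weak_grad \<Omega> \<theta>)) (weak_grad \<Omega> \<eta>)"
  using falk_winther assms unfolding falk_winther_interpolation_def linear_projection_def
  by (auto simp: lagrange_def)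

lemma interp_cell_le:
  "v \<in> H0_curl \<Omega> \<Longrightarrow> T \<in> \<T> \<Longrightarrow> L2_norm T (\<pi>E v) \<le>
     KF * (L2_norm (patch \<T> T) v + H * L2_norm (patch \<T> T) (weak_curl \<Omega> v))"
  using falk_winther by (simp add: falk_winther_interpolation_def)

lemma interp_le:
  assumes v: "v \<in> H0_curl \<Omega>"
  shows "(L2_norm \<Omega> (\<pi>E v))\<^sup>2
    \<le> 2 * KF\<^sup>2 * \<bar>overlap \<sigma> \<tau> 1\<bar> * ((L2_norm \<Omega> v)\<^sup>2 + H\<^sup>2 * (L2_norm \<Omega> (weak_curl \<Omega> v))\<^sup>2)"
proof -
  let ?g = "weak_curl \<Omega> v" and ?N = "\<lambda>T. (patch \<T> ^^ 1) T"
  have L: "v \<in> L2 \<Omega>" "?g \<in> L2 \<Omega>"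
    using v by (auto intro: H0_curl_L2 weak_curl_L2)
  have "(L2_norm \<Omega> (\<pi>E v))\<^sup>2 \<le> (\<Sum>T\<in>\<T>. (L2_norm T (\<pi>E v))\<^sup>2)"
    by (rule L2_norm_le_sum_cells[OF H0_curl_L2[OF interp_H0_curl[OF v]]])
  also have "\<dots> \<le> (\<Sum>T\<in>\<T>. 2 * KF\<^sup>2 * ((L2_norm (?N T) v)\<^sup>2 + H\<^sup>2 * (L2_norm (?N T) ?g)\<^sup>2))"
  proof (rule sum_mono)
    fix T assume "T \<in> \<T>"
    from interp_cell_le[OF v this] have "(L2_norm T (\<pi>E v))\<^sup>2 \<le> KF\<^sup>2 * (L2_norm (?N T) v + H * L2_norm (?N T) ?g)\<^sup>2"
      by (simp add: power_mono flip: power_mult_distrib)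
    also have "\<dots> \<le> KF\<^sup>2 * (2 * (L2_norm (?N T) v)\<^sup>2 + 2 * (H * L2_norm (?N T) ?g)\<^sup>2)"
      using norm_add_power2_le[of "L2_norm (?N T) v" "H * L2_norm (?N T) ?g"]
      by (intro mult_left_mono) (simp_all only: real_norm_def power2_abs zero_le_power2)
    finally show "(L2_norm T (\<pi>E v))\<^sup>2 \<le> 2 * KF\<^sup>2 * ((L2_norm (?N T) v)\<^sup>2 + H\<^sup>2 * (L2_norm (?N T) ?g)\<^sup>2)"
      by (simp add: power_mult_distrib algebra_simps)
  qed
  also have "\<dots> = 2 * KF\<^sup>2 * ((\<Sum>T\<in>\<T>. (L2_norm (?N T) v)\<^sup>2) + H\<^sup>2 * (\<Sum>T\<in>\<T>. (L2_norm (?N T) ?g)\<^sup>2))"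
    by (simp only: sum.distrib sum_distrib_left distrib_left)
  also have "\<dots> \<le> 2 * KF\<^sup>2 * (\<bar>overlap \<sigma> \<tau> 1\<bar> * (L2_norm \<Omega> v)\<^sup>2 + H\<^sup>2 * (\<bar>overlap \<sigma> \<tau> 1\<bar> * (L2_norm \<Omega> ?g)\<^sup>2))"
    using sum_patches_abs_le[OF L(1), of 1] sum_patches_abs_le[OF L(2), of 1]
    by (intro mult_left_mono add_mono) auto
  finally show ?thesis
    by (simp add: algebra_simps)
qed

text \<open>The weight 1 / H in the local bound yields the gain H; multiplied by \<omega>, it
  becomes the quantity made small by the resolution condition.\<close>

lemma regular_le:
  assumes w: "w \<in> H0_curl \<Omega>" and rd: "regular_decomposition \<Omega> \<T> KR \<pi>E w z \<theta>"
  shows "(L2_norm \<Omega> z)\<^sup>2 \<le> regular_constant \<sigma> \<tau> KR * H\<^sup>2 * (L2_norm \<Omega> (weak_curl \<Omega> w))\<^sup>2"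
proof -
  let ?g = "weak_curl \<Omega> w" and ?N = "\<lambda>T. (patch \<T> ^^ 3) T"
  have "(L2_norm \<Omega> z)\<^sup>2 \<le> (\<Sum>T\<in>\<T>. (L2_norm T z)\<^sup>2)"
    using rd by (intro L2_norm_le_sum_cells H10_vec_L2) (simp add: regular_decomposition_def)
  also have "\<dots> \<le> (\<Sum>T\<in>\<T>. KR\<^sup>2 * H\<^sup>2 * (L2_norm (?N T) ?g)\<^sup>2)"
  proof (rule sum_mono)
    fix T assume "T \<in> \<T>"
    then have "inverse H * L2_norm T z + L2_norm T (weak_jacobian \<Omega> z) \<le> KR * L2_norm (?N T) ?g"
      using rd by (auto simp: regular_decomposition_def Let_def)
    then have "inverse H * L2_norm T z \<le> KR * L2_norm (?N T) ?g"
      using L2_norm_nonneg[of T "weak_jacobian \<Omega> z"] by linarith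
    then have "L2_norm T z \<le> KR * H * L2_norm (?N T) ?g"
      using mesh_size_pos by (simp add: field_simps)
    then show "(L2_norm T z)\<^sup>2 \<le> KR\<^sup>2 * H\<^sup>2 * (L2_norm (?N T) ?g)\<^sup>2"
      by (simp add: power_mono flip: power_mult_distrib)
  qed
  also have "\<dots> = KR\<^sup>2 * H\<^sup>2 * (\<Sum>T\<in>\<T>. (L2_norm (?N T) ?g)\<^sup>2)"
    by (simp only: sum_distrib_left)
  also have "\<dots> \<le> KR\<^sup>2 * H\<^sup>2 * (\<bar>overlap \<sigma> \<tau> 3\<bar> * (L2_norm \<Omega> ?g)\<^sup>2)"
    using sum_patches_abs_le[OF weak_curl_L2[OF w], of 3] by (intro mult_left_mono) auto
  finally show ?thesis
    by (simp add: regular_constant_def algebra_simps)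
qed

context
  fixes w z :: "real^3 \<Rightarrow> complex^3" and \<theta> :: "real^3 \<Rightarrow> complex"
  assumes w: "w \<in> interpolation_kernel \<Omega> \<pi>E"
    and rd: "regular_decomposition \<Omega> \<T> KR \<pi>E w z \<theta>"
begin

lemma kernel_H0_curl: "w \<in> H0_curl \<Omega>" and kernel_interp: "ae_eq \<Omega> (\<pi>E w) (\<lambda>x. 0)"
  using w by (simp_all add: interpolation_kernel_def)

lemma potential_H10: "\<theta> \<in> H10 \<Omega>" and regular_part_L2: "z \<in> L2 \<Omega>"
  using rd by (simp_all add: regular_decomposition_def H10_vec_L2)

lemma kernel_decomposition: "ae_eq \<Omega> w (\<lambda>x. z x + weak_grad \<Omega> \<theta> x)"
proof -
  have "ae_eq \<Omega> (\<lambda>x. w x - \<pi>E w x) (\<lambda>x. z x + weak_grad \<Omega> \<theta> x)"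
    using rd by (simp add: regular_decomposition_def)
  then show ?thesis
    using kernel_interp unfolding ae_eq_def by eventually_elim simp
qed

lemma regular_part_ae: "ae_eq \<Omega> z (\<lambda>x. w x + (-1) *\<^sub>R weak_grad \<Omega> \<theta> x)"
  using kernel_decomposition unfolding ae_eq_def by eventually_elim simp

text \<open>Item 1 is curl z = curl w and item 2 membership of z in \<open>H0_curl\<close>, both
  from writing z as w - \<nabla>\<theta>.\<close>

lemmas regular_part =
  H0_curl_add_grad[OF open_domain bounded_domain regular_part_L2 kernel_H0_curl potential_H10 regular_part_ae]

text \<open>The field \<open>\<pi>E w\<close> belongs to the space and vanishes almost everywhere,
  so it represents zero. The zero field is the base point from which gradients are shown to lie in
  \<open>H0_curl\<close>.\<close>

lemma zero_H0_curl: "(\<lambda>x. 0) \<in> H0_curl \<Omega>"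
proof (rule H0_curl_cong_ae(2)[OF open_domain bounded_domain])
  show "\<pi>E w \<in> H0_curl \<Omega>"
    by (rule interp_H0_curl[OF kernel_H0_curl])
  show "ae_eq \<Omega> (\<lambda>x. 0) (\<pi>E w)"
    using kernel_interp unfolding ae_eq_def by eventually_elim simp
qed simp

lemma grad_H0_curl: "weak_grad \<Omega> \<theta> \<in> H0_curl \<Omega>"
  by (rule H0_curl_add_grad(2)[OF open_domain bounded_domain weak_grad_L2[OF potential_H10] zero_H0_curl
      potential_H10, where c=1]) (simp add: ae_eq_def)

lemma interp_regular_part:
  obtains \<eta> where "\<eta> \<in> H10 \<Omega>" "ae_eq \<Omega> (\<pi>E z) (\<lambda>x. - weak_grad \<Omega> \<eta> x)"
proof -
  obtain \<eta> where \<eta>: "\<eta> \<in> H10 \<Omega>" "ae_eq \<Omega> (\<pi>E (weak_grad \<Omega> \<theta>)) (weak_grad \<Omega> \<eta>)"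
    using interp_grad[OF potential_H10] .
  have "(\<lambda>x. z x + 1 *\<^sub>R weak_grad \<Omega> \<theta> x) \<in> L2 \<Omega>"
    by (rule L2_add_scaleR[OF regular_part_L2 weak_grad_L2[OF potential_H10]])
  then have sum: "(\<lambda>x. z x + weak_grad \<Omega> \<theta> x) \<in> L2 \<Omega>"
    by simp
  have "(\<lambda>x. z x + weak_grad \<Omega> \<theta> x) \<in> H0_curl \<Omega>"
  proof (rule H0_curl_cong_ae(2)[OF open_domain bounded_domain sum kernel_H0_curl])
    show "ae_eq \<Omega> (\<lambda>x. z x + weak_grad \<Omega> \<theta> x) w"
      using kernel_decomposition unfolding ae_eq_def by eventually_elim simp
  qed
  then have "ae_eq \<Omega> (\<pi>E w) (\<pi>E (\<lambda>x. z x + weak_grad \<Omega> \<theta> x))"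
    using interp_cong[OF kernel_H0_curl] kernel_decomposition by simp
  \<comment> \<open>Additivity gives 0 = \<pi>E w = \<pi>E z + \<pi>E (\<nabla>\<theta>), and the
    last term is \<nabla>\<eta>.\<close>
  then have "ae_eq \<Omega> (\<pi>E z) (\<lambda>x. - weak_grad \<Omega> \<eta> x)"
    using interp_add[OF regular_part(2) grad_H0_curl] kernel_interp \<eta>(2)
    unfolding ae_eq_def by eventually_elim (simp add: add_eq_0_iff2)
  then show ?thesis
    using that \<eta>(1) by blast
qed

definition corrected where "corrected = (\<lambda>x. z x - \<pi>E z x)"

text \<open>The double is written as a sum so that additivity of the interpolation applies
  directly.\<close>

definition test_field where "test_field = (\<lambda>x. corrected x + corrected x - w x)"

lemma corrected: "weak_curl \<Omega> corrected = weak_curl \<Omega> w" "corrected \<in> H0_curl \<Omega>"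
  and test_field: "weak_curl \<Omega> test_field = weak_curl \<Omega> w" "test_field \<in> H0_curl \<Omega>"
proof -
  obtain \<eta> where \<eta>: "\<eta> \<in> H10 \<Omega>" "ae_eq \<Omega> (\<pi>E z) (\<lambda>x. - weak_grad \<Omega> \<eta> x)"
    by (rule interp_regular_part)
  have cL2: "corrected \<in> L2 \<Omega>"
    unfolding corrected_def by (intro L2_diff regular_part_L2 H0_curl_L2 interp_H0_curl regular_part)
  have cae: "ae_eq \<Omega> corrected (\<lambda>x. z x + 1 *\<^sub>R weak_grad \<Omega> \<eta> x)"
    using \<eta>(2) unfolding ae_eq_def corrected_def by eventually_elim simp
  note c = H0_curl_add_grad[OF open_domain bounded_domain cL2 regular_part(2) \<eta>(1) cae]
  show "weak_curl \<Omega> corrected = weak_curl \<Omega> w" "corrected \<in> H0_curl \<Omega>"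
    using c regular_part by simp_all
  \<comment> \<open>The test field is z + 2 \<nabla>\<eta> - \<nabla>\<theta> almost everywhere;
    \<open>u\<close> is the intermediate field, since gradients are added one at a time.\<close>
  define u where "u = (\<lambda>x. z x + 2 *\<^sub>R weak_grad \<Omega> \<eta> x)"
  have uL2: "u \<in> L2 \<Omega>"
    unfolding u_def by (rule L2_add_scaleR[OF regular_part_L2 weak_grad_L2[OF \<eta>(1)]])
  have uae: "ae_eq \<Omega> u (\<lambda>x. z x + 2 *\<^sub>R weak_grad \<Omega> \<eta> x)"
    by (simp add: u_def ae_eq_def)
  note u = H0_curl_add_grad[OF open_domain bounded_domain uL2 regular_part(2) \<eta>(1) uae]
  have tL2: "test_field \<in> L2 \<Omega>"
    unfolding test_field_def using L2_add_scaleR[OF cL2 cL2, of 1] L2_diff H0_curl_L2[OF kernel_H0_curl] by auto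
  have tae: "ae_eq \<Omega> test_field (\<lambda>x. u x + (-1) *\<^sub>R weak_grad \<Omega> \<theta> x)"
    using cae kernel_decomposition unfolding ae_eq_def test_field_def u_def
    by eventually_elim (simp add: algebra_simps scaleR_2)
  note t = H0_curl_add_grad[OF open_domain bounded_domain tL2 u(2) potential_H10 tae]
  show "weak_curl \<Omega> test_field = weak_curl \<Omega> w" "test_field \<in> H0_curl \<Omega>"
    using t u regular_part by simp_all
qed

text \<open>Apply \<pi>E to z = \<open>corrected\<close> + \<pi>E z and cancel, as \<pi>E fixes
  \<pi>E z. Phrasing it as a sum makes additivity sufficient.\<close>

lemma interp_corrected: "ae_eq \<Omega> (\<pi>E corrected) (\<lambda>x. 0)"
proof -
  have "(\<lambda>x. corrected x + \<pi>E z x) = z"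
    by (simp add: corrected_def)
  then have "ae_eq \<Omega> (\<pi>E z) (\<lambda>x. \<pi>E corrected x + \<pi>E (\<pi>E z) x)"
    using interp_add[OF corrected(2) interp_H0_curl[OF regular_part(2)]] by simp
  moreover have "ae_eq \<Omega> (\<pi>E (\<pi>E z)) (\<pi>E z)"
    by (rule interp_projection[OF interp_nedelec[OF regular_part(2)]])
  ultimately show ?thesis
    unfolding ae_eq_def by eventually_elim simp
qed

lemma test_field_kernel: "test_field \<in> interpolation_kernel \<Omega> \<pi>E"
proof -
  \<comment> \<open>The subtraction of w is moved to the other side, so that again only additivity
    is used.\<close>
  have "(\<lambda>x. test_field x + w x) = (\<lambda>x. corrected x + corrected x)"
    by (simp add: test_field_def)
  then have "ae_eq \<Omega> (\<lambda>x. \<pi>E test_field x + \<pi>E w x) (\<lambda>x. \<pi>E corrected x + \<pi>E corrected x)"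
    using interp_add[OF test_field(2) kernel_H0_curl] interp_add[OF corrected(2) corrected(2)]
    unfolding ae_eq_def by (auto elim: eventually_elim2)
  then have "ae_eq \<Omega> (\<pi>E test_field) (\<lambda>x. 0)"
    using interp_corrected kernel_interp unfolding ae_eq_def by eventually_elim simp
  then show ?thesis
    using test_field(2) by (simp add: interpolation_kernel_def)
qed

lemma corrected_le:
  "(L2_norm \<Omega> corrected)\<^sup>2 \<le> kernel_constant \<sigma> \<tau> KF KR * H\<^sup>2 * (L2_norm \<Omega> (weak_curl \<Omega> w))\<^sup>2"
proof -
  let ?G = "H\<^sup>2 * (L2_norm \<Omega> (weak_curl \<Omega> w))\<^sup>2" and ?c = "regular_constant \<sigma> \<tau> KR"
  have z: "(L2_norm \<Omega> z)\<^sup>2 \<le> ?c * ?G"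
    using regular_le[OF kernel_H0_curl rd] by (simp add: mult.assoc)
  have "(L2_norm \<Omega> (\<pi>E z))\<^sup>2 \<le> 2 * KF\<^sup>2 * \<bar>overlap \<sigma> \<tau> 1\<bar> * ((L2_norm \<Omega> z)\<^sup>2 + ?G)"
    using interp_le[OF regular_part(2)] by (simp add: regular_part(1))
  also have "\<dots> \<le> 2 * KF\<^sup>2 * \<bar>overlap \<sigma> \<tau> 1\<bar> * (?c * ?G + ?G)"
    using z by (intro mult_left_mono add_right_mono) auto
  finally have "2 * (L2_norm \<Omega> z)\<^sup>2 + 2 * (L2_norm \<Omega> (\<pi>E z))\<^sup>2 \<le> kernel_constant \<sigma> \<tau> KF KR * ?G"
    using z by (simp add: kernel_constant_def algebra_simps)
  moreover have "(L2_norm \<Omega> corrected)\<^sup>2 \<le> 2 * (L2_norm \<Omega> z)\<^sup>2 + 2 * (L2_norm \<Omega> (\<pi>E z))\<^sup>2"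
    using L2_norm_add_scaleR[OF regular_part_L2 H0_curl_L2[OF interp_H0_curl[OF regular_part(2)]], of "-1"]
    by (simp add: corrected_def)
  ultimately show ?thesis
    by (simp add: mult.assoc)
qed

end

end

text \<open>As c \<ge> 1 implies c \<le> c^2, a constant for the squares also serves for the norms,
  without a square root.\<close>

lemma le_mult_of_power2_le:
  fixes x y c :: real
  assumes "0 \<le> x" "0 \<le> y" "1 \<le> c" "x\<^sup>2 \<le> c * y\<^sup>2"
  shows "x \<le> c * y"
proof -
  have "1 * y\<^sup>2 \<le> c * y\<^sup>2"
    using assms by (intro mult_right_mono) auto
  then have "c * y\<^sup>2 \<le> c * (c * y\<^sup>2)"
    using assms by (intro mult_left_mono) auto
  also have "c * (c * y\<^sup>2) = (c * y)\<^sup>2"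
    by (simp add: power2_eq_square)
  finally have "x\<^sup>2 \<le> (c * y)\<^sup>2"
    using assms(4) by linarith
  then show ?thesis
    by (rule power2_le_imp_le) (use assms in simp)
qed

section \<open>Norm equivalence and inf-sup bound on the kernel\<close>

context interpolation
begin

text \<open>Both norms share the curl term, and w and \<nabla>\<theta> differ by z, whose
  \<omega>-weighted norm that term controls. The factor 2 in \<open>C\<close> comes from the squared
  triangle inequality, used once in each direction.\<close>

lemma norm_equivalence:
  assumes w: "w \<in> interpolation_kernel \<Omega> \<pi>E" and rd: "regular_decomposition \<Omega> \<T> KR \<pi>E w z \<theta>"
    and \<omega>: "0 \<le> \<omega>" "\<omega> * H \<le> 1"
  defines "C \<equiv> 2 + 2 * regular_constant \<sigma> \<tau> KR"
  shows "curl_norm \<Omega> \<omega> w \<le> C * triple_norm \<Omega> \<omega> z \<theta>"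
    and "triple_norm \<Omega> \<omega> z \<theta> \<le> C * curl_norm \<Omega> \<omega> w"
proof -
  let ?a = "(L2_norm \<Omega> (weak_curl \<Omega> w))\<^sup>2" and ?k = "regular_constant \<sigma> \<tau> KR"
    and ?b = "\<omega>\<^sup>2 * (L2_norm \<Omega> w)\<^sup>2" and ?e = "\<omega>\<^sup>2 * (L2_norm \<Omega> (weak_grad \<Omega> \<theta>))\<^sup>2"
  note L2 = regular_part_L2[OF w rd] H0_curl_L2[OF kernel_H0_curl[OF w rd]] weak_grad_L2[OF potential_H10[OF w rd]]
  have k: "0 \<le> ?k"
    by (rule regular_constant_nonneg)
  have "\<omega>\<^sup>2 * (L2_norm \<Omega> z)\<^sup>2 \<le> \<omega>\<^sup>2 * (?k * H\<^sup>2 * ?a)"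
    using regular_le[OF kernel_H0_curl[OF w rd] rd] by (intro mult_left_mono) auto
  also have "\<dots> = (\<omega> * H)\<^sup>2 * (?k * ?a)"
    by (simp add: power_mult_distrib mult_ac)
  also have "\<dots> \<le> 1 * (?k * ?a)"
    using \<omega> k mesh_size_pos by (intro mult_right_mono) (auto simp: power_le_one)
  finally have z: "\<omega>\<^sup>2 * (L2_norm \<Omega> z)\<^sup>2 \<le> ?k * ?a"
    by simp
  have "(L2_norm \<Omega> w)\<^sup>2 = (L2_norm \<Omega> (\<lambda>x. z x + 1 *\<^sub>R weak_grad \<Omega> \<theta> x))\<^sup>2"
    using kernel_decomposition[OF w rd] L2_norm_cong_ae[OF L2(2) L2_add_scaleR[OF L2(1,3), of 1]] by simp
  also have "\<dots> \<le> 2 * (L2_norm \<Omega> z)\<^sup>2 + 2 * (L2_norm \<Omega> (weak_grad \<Omega> \<theta>))\<^sup>2"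
    using L2_norm_add_scaleR[OF L2(1,3), of 1] by simp
  finally have "?b \<le> \<omega>\<^sup>2 * (2 * (L2_norm \<Omega> z)\<^sup>2 + 2 * (L2_norm \<Omega> (weak_grad \<Omega> \<theta>))\<^sup>2)"
    by (rule mult_left_mono) simp
  then have b: "?b \<le> 2 * (?k * ?a) + 2 * ?e"
    using z by (simp add: distrib_left)
  have "ae_eq \<Omega> (weak_grad \<Omega> \<theta>) (\<lambda>x. w x + (-1) *\<^sub>R z x)"
    using kernel_decomposition[OF w rd] unfolding ae_eq_def by eventually_elim simp
  then have "(L2_norm \<Omega> (weak_grad \<Omega> \<theta>))\<^sup>2 = (L2_norm \<Omega> (\<lambda>x. w x + (-1) *\<^sub>R z x))\<^sup>2"
    using L2_norm_cong_ae[OF L2(3) L2_add_scaleR[OF L2(2,1), of "-1"]] by simp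
  also have "\<dots> \<le> 2 * (L2_norm \<Omega> w)\<^sup>2 + 2 * (L2_norm \<Omega> z)\<^sup>2"
    using L2_norm_add_scaleR[OF L2(2,1), of "-1"] by simp
  finally have "?e \<le> \<omega>\<^sup>2 * (2 * (L2_norm \<Omega> w)\<^sup>2 + 2 * (L2_norm \<Omega> z)\<^sup>2)"
    by (rule mult_left_mono) simp
  then have e: "?e \<le> 2 * (?k * ?a) + 2 * ?b"
    using z by (simp add: distrib_left)
  have N: "(curl_norm \<Omega> \<omega> w)\<^sup>2 = ?a + ?b" and T: "(triple_norm \<Omega> \<omega> z \<theta>)\<^sup>2 = ?a + ?e"
    by (simp_all add: curl_norm_power2 triple_norm_power2 regular_part(1)[OF w rd])
  have pos: "0 \<le> ?a" "0 \<le> ?b" "0 \<le> ?e" "0 \<le> ?k * ?b" "0 \<le> ?k * ?e"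
    using k by simp_all
  have C: "C * (?a + x) = 2 * ?a + 2 * x + 2 * (?k * ?a) + 2 * (?k * x)" for x
    by (simp add: C_def algebra_simps)
  have C1: "1 \<le> C"
    using k by (simp add: C_def)
  have nonneg: "0 \<le> triple_norm \<Omega> \<omega> z \<theta>"
    by (simp add: triple_norm_def)
  show "curl_norm \<Omega> \<omega> w \<le> C * triple_norm \<Omega> \<omega> z \<theta>"
    by (rule le_mult_of_power2_le[OF curl_norm_nonneg nonneg C1])
      (use b pos in \<open>simp only: N T C\<close>)
  show "triple_norm \<Omega> \<omega> z \<theta> \<le> C * curl_norm \<Omega> \<omega> w"
    by (rule le_mult_of_power2_le[OF nonneg curl_norm_nonneg C1])
      (use e pos in \<open>simp only: N T C\<close>)
qed

text \<open>The two inequalities on d say that the perturbation takes at most half of the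
  \<epsilon>-term and half of the \<mu>-term. What remains is half the smaller ellipticity constant;
  \<open>C\<close> accounts for the size of the test field relative to w.\<close>

lemma inf_sup_witness:
  assumes w: "w \<in> nonzero_kernel \<Omega> \<pi>E" and rd: "regular_decomposition \<Omega> \<T> KR \<pi>E w z \<theta>"
    and \<mu>: "elliptic_coefficient \<Omega> a\<mu> M\<mu> \<mu>" and \<epsilon>: "elliptic_coefficient \<Omega> a\<epsilon> M\<epsilon> \<epsilon>"
    and \<omega>: "0 < \<omega>" "\<omega> * H \<le> c0" "0 < c0" "c0 \<le> 1"
    and a: "0 < a\<mu>" "0 < a\<epsilon>"
    and d: "0 < d" "2 * \<bar>M\<epsilon>\<bar> * d \<le> a\<epsilon>" "2 * \<bar>M\<epsilon>\<bar> * kernel_constant \<sigma> \<tau> KF KR / d * c0 \<le> a\<mu>"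
  defines "C \<equiv> 2 + 8 * kernel_constant \<sigma> \<tau> KF KR"
  shows "\<exists>\<phi>\<in>nonzero_kernel \<Omega> \<pi>E. min a\<mu> a\<epsilon> / 2 / C
    \<le> cmod (B_form \<Omega> \<mu> \<epsilon> \<omega> w \<phi>) / (curl_norm \<Omega> \<omega> w * curl_norm \<Omega> \<omega> \<phi>)"
proof -
  have wk: "w \<in> interpolation_kernel \<Omega> \<pi>E" and w0: "\<not> ae_eq \<Omega> w (\<lambda>x. 0)"
    using w by (simp_all add: nonzero_kernel_def)
  let ?g = "weak_curl \<Omega> w" and ?k = "kernel_constant \<sigma> \<tau> KF KR" and ?m = "min a\<mu> a\<epsilon> / 2"
  let ?a = "(L2_norm \<Omega> ?g)\<^sup>2" and ?b = "\<omega>\<^sup>2 * (L2_norm \<Omega> w)\<^sup>2"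
  define \<zeta> where "\<zeta> = corrected z"
  define \<phi> where "\<phi> = test_field w z"
  have \<phi>_eq: "\<phi> = (\<lambda>x. (\<lambda>x. 2 *\<^sub>R \<zeta> x) x + (-1) *\<^sub>R w x)"
    by (simp add: \<phi>_def \<zeta>_def test_field_def[OF wk rd] scaleR_2)
  have w_eq: "w = (\<lambda>x. (\<lambda>x. 2 *\<^sub>R \<zeta> x) x + (-1) *\<^sub>R \<phi> x)"
    by (simp add: \<phi>_eq)
  have H0: "w \<in> H0_curl \<Omega>" "\<zeta> \<in> H0_curl \<Omega>" "\<phi> \<in> H0_curl \<Omega>"
    using kernel_H0_curl[OF wk rd] corrected[OF wk rd] test_field[OF wk rd] by (simp_all add: \<zeta>_def \<phi>_def)
  have L2: "w \<in> L2 \<Omega>" "\<zeta> \<in> L2 \<Omega>" "\<phi> \<in> L2 \<Omega>" "?g \<in> L2 \<Omega>"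
    using H0 by (auto intro: H0_curl_L2 weak_curl_L2)
  have \<zeta>2: "(\<lambda>x. 2 *\<^sub>R \<zeta> x) \<in> L2 \<Omega>"
    using L2_add_scaleR[OF L2_zero L2(2), of 2] by simp
  have curl\<phi>: "weak_curl \<Omega> \<phi> = ?g"
    using test_field[OF wk rd] by (simp add: \<phi>_def)
  have k: "0 \<le> ?k"
    by (rule kernel_constant_nonneg)
  have c: "(L2_norm \<Omega> \<zeta>)\<^sup>2 \<le> ?k * H\<^sup>2 * ?a"
    using corrected_le[OF wk rd] by (simp add: \<zeta>_def)
  have "\<omega>\<^sup>2 * (L2_norm \<Omega> \<zeta>)\<^sup>2 \<le> \<omega>\<^sup>2 * (?k * H\<^sup>2 * ?a)"
    using c by (intro mult_left_mono) auto
  also have "\<dots> = (\<omega> * H)\<^sup>2 * (?k * ?a)"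
    by (simp add: power_mult_distrib mult_ac)
  also have "\<dots> \<le> c0 * (?k * ?a)"
  proof (rule mult_right_mono)
    \<comment> \<open>One factor is bounded by c0 and the other by 1, so the smallness condition
      stays linear in c0.\<close>
    have "(\<omega> * H) * (\<omega> * H) \<le> c0 * 1"
      using \<omega> mesh_size_pos by (intro mult_mono) auto
    then show "(\<omega> * H)\<^sup>2 \<le> c0"
      by (simp add: power2_eq_square)
  qed (use k in simp)
  finally have \<zeta>_le: "\<omega>\<^sup>2 * (L2_norm \<Omega> \<zeta>)\<^sup>2 \<le> c0 * (?k * ?a)" .
  also have "\<dots> \<le> 1 * (?k * ?a)"
    using \<omega> k by (intro mult_right_mono) auto
  finally have \<zeta>_le1: "\<omega>\<^sup>2 * (L2_norm \<Omega> \<zeta>)\<^sup>2 \<le> ?k * ?a"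
    by simp
  \<comment> \<open>The supremum runs over nonzero fields. If \<open>\<phi>\<close> vanished, so
    would its curl, which is the curl of w; then \<open>\<zeta>\<close> = 0 by its bound, and w = 2
    \<open>\<zeta>\<close> - \<open>\<phi>\<close> = 0.\<close>
  have "\<not> ae_eq \<Omega> \<phi> (\<lambda>x. 0)"
  proof
    assume \<phi>0: "ae_eq \<Omega> \<phi> (\<lambda>x. 0)"
    have "ae_eq \<Omega> ?g (\<lambda>x. 0)"
      using weak_curl_zero[OF open_domain bounded_domain H0(3) \<phi>0] curl\<phi> by simp
    then have "(L2_norm \<Omega> \<zeta>)\<^sup>2 \<le> 0"
      using c L2_norm_eq_0_iff[OF L2(4)] by simp
    then have "ae_eq \<Omega> \<zeta> (\<lambda>x. 0)"
      using L2_norm_eq_0_iff[OF L2(2)] by simp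
    then have "ae_eq \<Omega> w (\<lambda>x. 0)"
      using \<phi>0 unfolding ae_eq_def by eventually_elim (simp add: \<phi>_eq)
    then show False
      using w0 by simp
  qed
  then have \<phi>: "\<phi> \<in> nonzero_kernel \<Omega> \<pi>E"
    using test_field_kernel[OF wk rd] by (simp add: nonzero_kernel_def \<phi>_def)
  have pos: "0 < curl_norm \<Omega> \<omega> v" if "v \<in> L2 \<Omega>" "\<not> ae_eq \<Omega> v (\<lambda>x. 0)" for v
  proof -
    have "0 < (L2_norm \<Omega> v)\<^sup>2"
      using L2_norm_eq_0_iff[OF that(1)] that(2) by simp
    then have "0 < (curl_norm \<Omega> \<omega> v)\<^sup>2"
      using \<omega> by (simp add: curl_norm_power2 add_nonneg_pos)
    then show ?thesis
      using curl_norm_nonneg[of \<Omega> \<omega> v] by (simp add: less_le)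
  qed
  have N: "(curl_norm \<Omega> \<omega> w)\<^sup>2 = ?a + ?b"
    by (simp add: curl_norm_power2)
  let ?\<mu> = "L2_inner \<Omega> (\<lambda>x. real_matrix_mult (\<mu> x) (?g x)) ?g"
    and ?\<epsilon> = "L2_inner \<Omega> (\<lambda>x. real_matrix_mult (\<epsilon> x) (w x))"
  have "?\<epsilon> (\<lambda>x. 2 *\<^sub>R \<zeta> x) = 2 *\<^sub>R ?\<epsilon> \<zeta>"
    using L2_inner_add_scaleR_right[OF L2_zero L2(2) elliptic_L2[OF \<epsilon> L2(1)], of 2]
    by (simp add: L2_inner_def)
  then have "?\<epsilon> \<phi> = 2 *\<^sub>R ?\<epsilon> \<zeta> - ?\<epsilon> w"
    using L2_inner_add_scaleR_right[OF \<zeta>2 L2(1) elliptic_L2[OF \<epsilon> L2(1)], of "-1"] by (simp add: \<phi>_eq)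
  then have \<epsilon>\<phi>: "Re (?\<epsilon> \<phi>) = 2 * Re (?\<epsilon> \<zeta>) - Re (?\<epsilon> w)"
    by simp
  have "Re (B_form \<Omega> \<mu> \<epsilon> \<omega> w \<phi>) = Re ?\<mu> - \<omega>\<^sup>2 * Re (?\<epsilon> \<phi>)"
    by (simp add: B_form_def curl\<phi>)
  also have "\<dots> = Re ?\<mu> + \<omega>\<^sup>2 * Re (?\<epsilon> w) - \<omega>\<^sup>2 * (2 * Re (?\<epsilon> \<zeta>))"
    unfolding \<epsilon>\<phi> by (simp add: right_diff_distrib)
  finally have "Re (B_form \<Omega> \<mu> \<epsilon> \<omega> w \<phi>) = Re ?\<mu> + \<omega>\<^sup>2 * Re (?\<epsilon> w) - \<omega>\<^sup>2 * (2 * Re (?\<epsilon> \<zeta>))" .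
  moreover have "a\<mu> * ?a \<le> Re ?\<mu>"
    by (rule elliptic_coercive[OF \<mu> L2(4)])
  moreover have "\<omega>\<^sup>2 * (a\<epsilon> * (L2_norm \<Omega> w)\<^sup>2) \<le> \<omega>\<^sup>2 * Re (?\<epsilon> w)"
    using elliptic_coercive[OF \<epsilon> L2(1)] by (intro mult_left_mono) auto
  moreover have "\<omega>\<^sup>2 * (2 * Re (?\<epsilon> \<zeta>)) \<le> a\<epsilon> * ?b / 2 + a\<mu> * ?a / 2"
  proof -
    have "\<omega>\<^sup>2 * (2 * Re (?\<epsilon> \<zeta>)) \<le> \<omega>\<^sup>2 * (\<bar>M\<epsilon>\<bar> * (d * (L2_norm \<Omega> w)\<^sup>2 + (L2_norm \<Omega> \<zeta>)\<^sup>2 / d))"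
      using elliptic_Young[OF \<epsilon> L2(1,2) d(1)] by (intro mult_left_mono) auto
    also have "\<dots> = (\<bar>M\<epsilon>\<bar> * d) * ?b + \<bar>M\<epsilon>\<bar> / d * (\<omega>\<^sup>2 * (L2_norm \<Omega> \<zeta>)\<^sup>2)"
      by (simp add: algebra_simps)
    also have "\<dots> \<le> (a\<epsilon> / 2) * ?b + \<bar>M\<epsilon>\<bar> / d * (c0 * (?k * ?a))"
      using d \<zeta>_le by (intro add_mono mult_right_mono mult_left_mono) auto
    also have "\<bar>M\<epsilon>\<bar> / d * (c0 * (?k * ?a)) = (\<bar>M\<epsilon>\<bar> * ?k / d * c0) * ?a"
      by (simp add: mult_ac)
    also have "(a\<epsilon> / 2) * ?b + (\<bar>M\<epsilon>\<bar> * ?k / d * c0) * ?a \<le> (a\<epsilon> / 2) * ?b + (a\<mu> / 2) * ?a"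
      using d(3) by (intro add_left_mono mult_right_mono) (simp_all add: mult_ac)
    finally show ?thesis by simp
  qed
  ultimately have "a\<mu> * ?a / 2 + a\<epsilon> * ?b / 2 \<le> Re (B_form \<Omega> \<mu> \<epsilon> \<omega> w \<phi>)"
    by (simp add: algebra_simps)
  moreover have "?m * ?a \<le> a\<mu> / 2 * ?a" "?m * ?b \<le> a\<epsilon> / 2 * ?b"
    by (intro mult_right_mono; simp)+
  ultimately have "?m * (curl_norm \<Omega> \<omega> w)\<^sup>2 \<le> Re (B_form \<Omega> \<mu> \<epsilon> \<omega> w \<phi>)"
    unfolding N distrib_left by linarith
  also have "\<dots> \<le> cmod (B_form \<Omega> \<mu> \<epsilon> \<omega> w \<phi>)"
    by (rule complex_Re_le_cmod)
  finally have B: "?m * (curl_norm \<Omega> \<omega> w)\<^sup>2 \<le> cmod (B_form \<Omega> \<mu> \<epsilon> \<omega> w \<phi>)" .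
  have C1: "1 \<le> C"
    using k by (simp add: C_def)
  have "curl_norm \<Omega> \<omega> \<phi> \<le> C * curl_norm \<Omega> \<omega> w"
  proof (rule le_mult_of_power2_le[OF curl_norm_nonneg curl_norm_nonneg C1])
    \<comment> \<open>The 8 in \<open>C\<close> is 2 from the squared triangle inequality times 4
      from doubling \<open>\<zeta>\<close>.\<close>
    have "(L2_norm \<Omega> \<phi>)\<^sup>2 \<le> 2 * (L2_norm \<Omega> (\<lambda>x. 2 *\<^sub>R \<zeta> x))\<^sup>2 + 2 * (L2_norm \<Omega> w)\<^sup>2"
      using L2_norm_add_scaleR[OF \<zeta>2 L2(1), of "-1"] by (simp add: \<phi>_eq)
    also have "(L2_norm \<Omega> (\<lambda>x. 2 *\<^sub>R \<zeta> x))\<^sup>2 = 4 * (L2_norm \<Omega> \<zeta>)\<^sup>2"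
      by (simp add: L2_norm_power2 power_mult_distrib)
    finally have "\<omega>\<^sup>2 * (L2_norm \<Omega> \<phi>)\<^sup>2 \<le> \<omega>\<^sup>2 * (2 * (4 * (L2_norm \<Omega> \<zeta>)\<^sup>2) + 2 * (L2_norm \<Omega> w)\<^sup>2)"
      by (rule mult_left_mono) simp
    then have "\<omega>\<^sup>2 * (L2_norm \<Omega> \<phi>)\<^sup>2 \<le> 8 * (?k * ?a) + 2 * ?b"
      using \<zeta>_le1 by (simp add: algebra_simps)
    moreover have "C * (?a + ?b) = 2 * ?a + 2 * ?b + 8 * (?k * ?a) + 8 * (?k * ?b)"
      by (simp add: C_def algebra_simps)
    moreover have "0 \<le> ?a" "0 \<le> ?k * ?b"
      using k by simp_all
    ultimately show "(curl_norm \<Omega> \<omega> \<phi>)\<^sup>2 \<le> C * (curl_norm \<Omega> \<omega> w)\<^sup>2"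
      unfolding N curl_norm_power2[of \<Omega> \<omega> \<phi>] curl\<phi> by linarith
  qed
  moreover have p: "0 < curl_norm \<Omega> \<omega> w" "0 < curl_norm \<Omega> \<omega> \<phi>"
    using pos L2 w0 \<phi> by (auto simp: nonzero_kernel_def)
  moreover have m: "0 \<le> ?m / C"
    using a C1 by simp
  ultimately have "?m / C * (curl_norm \<Omega> \<omega> w * curl_norm \<Omega> \<omega> \<phi>)
      \<le> ?m / C * (curl_norm \<Omega> \<omega> w * (C * curl_norm \<Omega> \<omega> w))"
    by (intro mult_left_mono) auto
  also have "\<dots> = ?m * (curl_norm \<Omega> \<omega> w)\<^sup>2"
    using C1 by (simp add: power2_eq_square)
  also note B
  finally show ?thesis
    using \<phi> p by (intro bexI[of _ \<phi>]) (simp_all add: pos_le_divide_eq)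
qed

end

theorem lemma3p1:
  fixes \<Omega> :: "(real^3) set"
    and \<sigma> \<tau> a\<mu> M\<mu> a\<epsilon> M\<epsilon> \<omega>0 KF KR :: real
  assumes "admissible_domain \<Omega>"
    and "a\<mu> > 0" and "a\<epsilon> > 0" and "\<omega>0 > 0"
  shows "\<exists>c0 C \<alpha>. c0 > 0 \<and> C \<ge> 1 \<and> \<alpha> > 0 \<and>
    (\<forall>\<mu> \<epsilon> \<T> \<pi>E \<omega>.
       elliptic_coefficient \<Omega> a\<mu> M\<mu> \<mu> \<and> elliptic_coefficient \<Omega> a\<epsilon> M\<epsilon> \<epsilon> \<and>
       admissible_mesh \<Omega> \<sigma> \<tau> \<T> \<and>
       falk_winther_interpolation \<Omega> \<T> KF \<pi>E \<and>
       (\<forall>v\<in>H0_curl \<Omega>. \<exists>z \<theta>. regular_decomposition \<Omega> \<T> KR \<pi>E v z \<theta>) \<and>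
       \<omega> \<ge> \<omega>0 \<and> uniquely_solvable \<Omega> \<mu> \<epsilon> \<omega> \<and>
       \<omega> * mesh_size \<T> \<le> c0 \<longrightarrow>
       (\<forall>w\<in>interpolation_kernel \<Omega> \<pi>E. \<forall>z \<theta>. regular_decomposition \<Omega> \<T> KR \<pi>E w z \<theta> \<longrightarrow>
          inverse C * curl_norm \<Omega> \<omega> w \<le> triple_norm \<Omega> \<omega> z \<theta> \<and>
          triple_norm \<Omega> \<omega> z \<theta> \<le> C * curl_norm \<Omega> \<omega> w) \<and>
       (INF w\<in>nonzero_kernel \<Omega> \<pi>E. SUP \<phi>\<in>nonzero_kernel \<Omega> \<pi>E.
          ereal (cmod (B_form \<Omega> \<mu> \<epsilon> \<omega> w \<phi>) / (curl_norm \<Omega> \<omega> w * curl_norm \<Omega> \<omega> \<phi>)))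
        \<ge> ereal \<alpha>)"
proof -
  define k where "k = kernel_constant \<sigma> \<tau> KF KR"
  \<comment> \<open>Gives 2 |M\<epsilon>| d \<le> a\<epsilon>; the added 1 prevents division by
    zero.\<close>
  define d where "d = a\<epsilon> / (2 * (\<bar>M\<epsilon>\<bar> + 1))"
  define X where "X = 2 * \<bar>M\<epsilon>\<bar> * k / d"
  \<comment> \<open>The second entry gives X c0 \<le> a\<mu>, with the added 1 covering X = 0. The
    first entry ensures \<omega> H \<le> 1, as part (i) requires.\<close>
  define c0 where "c0 = min 1 (a\<mu> / (X + 1))"
  define C where "C = 2 + 2 * regular_constant \<sigma> \<tau> KR"
  define \<alpha> where "\<alpha> = min a\<mu> a\<epsilon> / 2 / (2 + 8 * k)"
  have k: "0 \<le> k"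
    by (simp add: k_def kernel_constant_nonneg)
  have d: "0 < d" "2 * \<bar>M\<epsilon>\<bar> * d \<le> a\<epsilon>"
    using assms by (simp_all add: d_def field_simps)
  have X: "0 \<le> X"
    using k d by (simp add: X_def)
  have c0: "0 < c0" "c0 \<le> 1"
    using X assms by (simp_all add: c0_def)
  have "X * c0 \<le> X * (a\<mu> / (X + 1))"
    using X by (intro mult_left_mono) (simp_all add: c0_def)
  also have "\<dots> \<le> a\<mu>"
    using X assms by (simp add: field_simps)
  finally have Xc0: "2 * \<bar>M\<epsilon>\<bar> * kernel_constant \<sigma> \<tau> KF KR / d * c0 \<le> a\<mu>"
    by (simp add: X_def k_def)
  have C: "1 \<le> C"
    using regular_constant_nonneg[of \<sigma> \<tau> KR] by (simp add: C_def)
  have \<alpha>: "0 < \<alpha>"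
    using assms k by (simp add: \<alpha>_def)
  show ?thesis
  proof (rule exI[of _ c0], rule exI[of _ C], rule exI[of _ \<alpha>], intro conjI[OF c0(1)] conjI[OF C] conjI[OF \<alpha>] allI impI,
      elim conjE, goal_cases)
    case (1 \<mu> \<epsilon> \<T> \<pi>E \<omega>)
    then interpret interpolation \<Omega> \<sigma> \<tau> \<T> KF KR \<pi>E
      using assms by unfold_locales simp_all
    have \<omega>: "0 < \<omega>" "0 \<le> \<omega>" "\<omega> * mesh_size \<T> \<le> c0" "\<omega> * mesh_size \<T> \<le> 1"
      using 1 assms(4) c0 by auto
    have "inverse C * curl_norm \<Omega> \<omega> w \<le> triple_norm \<Omega> \<omega> z \<theta> \<and>
          triple_norm \<Omega> \<omega> z \<theta> \<le> C * curl_norm \<Omega> \<omega> w"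
      if w: "w \<in> interpolation_kernel \<Omega> \<pi>E" "regular_decomposition \<Omega> \<T> KR \<pi>E w z \<theta>" for w z \<theta>
      using norm_equivalence[OF w \<omega>(2,4)] C by (simp add: C_def[symmetric] field_simps)
    moreover have "ereal \<alpha> \<le> (INF w\<in>nonzero_kernel \<Omega> \<pi>E. SUP \<phi>\<in>nonzero_kernel \<Omega> \<pi>E.
          ereal (cmod (B_form \<Omega> \<mu> \<epsilon> \<omega> w \<phi>) / (curl_norm \<Omega> \<omega> w * curl_norm \<Omega> \<omega> \<phi>)))"
    \<comment> \<open>In the extended reals this also covers a trivial kernel, whose infimum is
      infinite, and the inner supremum needs no upper bound.\<close>
    proof (rule INF_greatest)
      fix w assume w: "w \<in> nonzero_kernel \<Omega> \<pi>E"
      then obtain z \<theta> where rd: "regular_decomposition \<Omega> \<T> KR \<pi>E w z \<theta>"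
        using 1 by (auto simp: nonzero_kernel_def interpolation_kernel_def)
      obtain \<phi> where "\<phi> \<in> nonzero_kernel \<Omega> \<pi>E" "\<alpha> \<le> cmod (B_form \<Omega> \<mu> \<epsilon> \<omega> w \<phi>) /
          (curl_norm \<Omega> \<omega> w * curl_norm \<Omega> \<omega> \<phi>)"
        using inf_sup_witness[OF w rd 1(1,2) \<omega>(1,3) c0 assms(2,3) d Xc0] by (auto simp: \<alpha>_def k_def)
      then show "ereal \<alpha> \<le> (SUP \<phi>\<in>nonzero_kernel \<Omega> \<pi>E.
          ereal (cmod (B_form \<Omega> \<mu> \<epsilon> \<omega> w \<phi>) / (curl_norm \<Omega> \<omega> w * curl_norm \<Omega> \<omega> \<phi>)))"
        by (intro SUP_upper2) auto
    qed
    ultimately show ?case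
      by blast
  qed
qed

end
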